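(* Fix positive coset-depending weights $w_i:S_{-i}\to(0,\infty)$, $i=1,\dots,n$, $n\ge2$. For $r=1,\dots,n-1$ let $J_r$ be the collection of all column vectors in $\mathbb{R}^{nk}$, with $n$ blocks in $\mathbb{R}^k$, of the form $$\begin{bmatrix}\Lambda_1^{-1}\,(\delta_{k_1}^1-\delta_{k_1}^{i_1})\,\delta_{k_2}^1\delta_{k_3}^1\cdots\delta_{k_r}^1\,(\delta_{k_{r+1}}^1-\delta_{k_{r+1}}^{i_{r+1}})\,\delta_{k_{r+2}}^{i_{r+2}}\cdots\delta_{k_n}^{i_n}\\[2pt] \Lambda_2^{-1}\,\delta_{k_1}^{i_1}(\delta_{k_2}^1-\delta_{k_2}^{i_2})\,\delta_{k_3}^1\cdots\delta_{k_r}^1\,(\delta_{k_{r+1}}^1-\delta_{k_{r+1}}^{i_{r+1}})\,\delta_{k_{r+2}}^{i_{r+2}}\cdots\delta_{k_n}^{i_n}\\ \vdots\\ \Lambda_r^{-1}\,\delta_{k_1}^{i_1}\cdots\delta_{k_{r-1}}^{i_{r-1}}(\delta_{k_r}^1-\delta_{k_r}^{i_r})\,(\delta_{k_{r+1}}^1-\delta_{k_{r+1}}^{i_{r+1}})\,\delta_{k_{r+2}}^{i_{r+2}}\cdots\delta_{k_n}^{i_n}\\[2pt] -\Lambda_{r+1}^{-1}\,(\delta_{k_1}^1\cdots\delta_{k_r}^1-\delta_{k_1}^{i_1}\cdots\delta_{k_r}^{i_r})(\delta_{k_{r+1}}^1-\delta_{k_{r+1}}^{i_{r+1}})\,\delta_{k_{r+2}}^{i_{r+2}}\cdots\delta_{k_n}^{i_n}\\[2pt]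 \mathbf{0}_{(n-r-1)k}\end{bmatrix}$$ where $(i_1,\dots,i_n)$ ranges over $\prod_p\{1,\dots,k_p\}$ with $i_{r+1}\ne1$ and $(i_1,\dots,i_r)\ne(1,\dots,1)$. Let $B_{cw}^H=[J_1,J_2,\dots,J_{n-1}]$ be the matrix whose columns are all these vectors. Then $B_{cw}^H$ has full column rank, the subspace $\mathcal{H}^{cw}$ of coset weighted pure harmonic games satisfies $$\mathcal{H}^{cw}=\mathrm{Span}(B_{cw}^H)\quad(\text{column span}),$$ and the columns of $B_{cw}^H$ form a basis of $\mathcal{H}^{cw}$.
   Context: A finite normal form game $G$ has players $N=\{1,\dots,n\}$, strategy sets $S_i=\{1,\dots,k_i\}$ with $k_i\ge2$, profiles $S=\prod_i S_i$, $S_{-i}=\prod_{j\ne i}S_j$, payoffs $c_i:S\to\mathbb{R}$. Put $k=\prod_j k_j$. $\delta_m^j$ is the $j$-th column of $I_m$; a product of column vectors written by juxtaposition is the Kronecker product (semi-tensor product of columns), formed before $\Lambda_q^{-1}$ is applied. For a profile $s$ put $x_j=\delta_{k_j}^{s_j}$. The structure vector of $c_i$ is the row vector $V_i^c\in\mathbb{R}^k$ with $c_i(s)=V_i^c(x_1\otimes\cdots\otimes x_n)$, and $V_G=[V_1^c,\dots,V_n^c]\in\mathbb{R}^{nk}$; games are identified with vectors $V_G^T\in\mathbb{R}^{nk}$. The row vector $V_i^w\in\mathbb{R}^{k/k_i}$ is defined by $w_i(s_{-i})=V_i^w\,\bigotimes_{j\ne i}x_j$ (factors in increasing order of $j$).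 $E_i:=I_{k_1\cdots k_{i-1}}\otimes\mathbf{1}_{k_i}\otimes I_{k_{i+1}\cdots k_n}$ ($\mathbf{1}_m$ the all-ones column, empty products are $1$), and $\Lambda_i$ is the $k\times k$ diagonal matrix whose diagonal entries are the entries of $V_i^wE_i^T\in\mathbb{R}^k$. $G$ is a coset weighted potential game with weights $w_i$ if there is $P:S\to\mathbb{R}$ with $c_i(x,s_{-i})-c_i(y,s_{-i})=w_i(s_{-i})(P(x,s_{-i})-P(y,s_{-i}))$ for all $i\in N$, $x,y\in S_i$, $s_{-i}\in S_{-i}$; $\mathcal{G}_P^{cw}\subseteq\mathbb{R}^{nk}$ is the subspace of all such $V_G^T$. The subspace $\mathcal{H}^{cw}$ of coset weighted pure harmonic games is the orthogonal complement of $\mathcal{G}_P^{cw}$ in $\mathbb{R}^{nk}$ for the standard inner product. *)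

theory Defs
  imports "Jordan_Normal_Form.DL_Rank" "HOL-Library.FuncSet"
begin

section \<open>Kronecker products and block vectors\<close>

text \<open>Vectors and matrices are indexed from 0, whereas players and strategies are numbered from 1.\<close>

definition kron_vec :: "real vec \<Rightarrow> real vec \<Rightarrow> real vec" (infixr "\<otimes>\<^sub>v" 68) where
  "u \<otimes>\<^sub>v v = vec (dim_vec u * dim_vec v) (\<lambda>l. u $ (l div dim_vec v) * v $ (l mod dim_vec v))"

definition kron_mat :: "real mat \<Rightarrow> real mat \<Rightarrow> real mat" (infixr "\<otimes>\<^sub>m" 68) where
  "A \<otimes>\<^sub>m B = mat (dim_row A * dim_row B) (dim_col A * dim_col B)
     (\<lambda>(l, m). A $$ (l div dim_row B, m div dim_col B) * B $$ (l mod dim_row B, m mod dim_col B))"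

definition kron_list :: "real vec list \<Rightarrow> real vec" where
  "kron_list vs = foldr (\<otimes>\<^sub>v) vs (vec 1 (\<lambda>_. 1))"

definition concat_vec :: "real vec list \<Rightarrow> real vec" where
  "concat_vec vs = foldr (@\<^sub>v) vs vNil"

definition delta :: "nat \<Rightarrow> nat \<Rightarrow> real vec" where
  "delta m j = unit_vec m (j - 1)"


section \<open>Games and structure vectors\<close>

text \<open>The players are \<open>1, \<dots>, n\<close> and player \<open>j\<close> has the strategies \<open>1, \<dots>, k j\<close>. The set \<open>S\<close> is
  \<open>profiles k {1..n}\<close> and \<open>S\<^bsub>-i\<^esub>\<close> is \<open>profiles k ({1..n} - {i})\<close>; for \<open>s \<in> S\<^bsub>-i\<^esub>\<close> the profile
  \<open>(x, s)\<close> is \<open>s(i := x)\<close>.\<close>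

definition profiles :: "(nat \<Rightarrow> nat) \<Rightarrow> nat set \<Rightarrow> (nat \<Rightarrow> nat) set" where
  "profiles k J = (\<Pi>\<^sub>E j\<in>J. {1..k j})"

definition num_profiles :: "nat \<Rightarrow> (nat \<Rightarrow> nat) \<Rightarrow> nat" where
  "num_profiles n k = (\<Prod>j\<in>{1..n}. k j)"

text \<open>The list \<open>js\<close> gives the players on which \<open>f\<close> depends, in the order of the Kronecker factors.\<close>

definition structure_vec :: "(nat \<Rightarrow> nat) \<Rightarrow> nat list \<Rightarrow> ((nat \<Rightarrow> nat) \<Rightarrow> real) \<Rightarrow> real vec" where
  "structure_vec k js f = (THE V. V \<in> carrier_vec (\<Prod>j\<in>set js. k j) \<and>
     (\<forall>s\<in>profiles k (set js). f s = V \<bullet> kron_list (map (\<lambda>j. delta (k j) (s j)) js)))"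

definition game_vec :: "nat \<Rightarrow> (nat \<Rightarrow> nat) \<Rightarrow> (nat \<Rightarrow> (nat \<Rightarrow> nat) \<Rightarrow> real) \<Rightarrow> real vec" where
  "game_vec n k c = concat_vec (map (\<lambda>i. structure_vec k [1..<Suc n] (c i)) [1..<Suc n])"

definition coset_weighted_potential_game ::
  "nat \<Rightarrow> (nat \<Rightarrow> nat) \<Rightarrow> (nat \<Rightarrow> (nat \<Rightarrow> nat) \<Rightarrow> real) \<Rightarrow> (nat \<Rightarrow> (nat \<Rightarrow> nat) \<Rightarrow> real) \<Rightarrow> bool" where
  "coset_weighted_potential_game n k w c \<longleftrightarrow>
     (\<exists>P :: (nat \<Rightarrow> nat) \<Rightarrow> real. \<forall>i\<in>{1..n}. \<forall>s\<in>profiles k ({1..n} - {i}). \<forall>x\<in>{1..k i}. \<forall>y\<in>{1..k i}.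
        c i (s(i := x)) - c i (s(i := y)) = w i s * (P (s(i := x)) - P (s(i := y))))"

definition potential_games :: "nat \<Rightarrow> (nat \<Rightarrow> nat) \<Rightarrow> (nat \<Rightarrow> (nat \<Rightarrow> nat) \<Rightarrow> real) \<Rightarrow> real vec set" where
  "potential_games n k w = {game_vec n k c | c. coset_weighted_potential_game n k w c}"

definition pure_harmonic_games ::
  "nat \<Rightarrow> (nat \<Rightarrow> nat) \<Rightarrow> (nat \<Rightarrow> (nat \<Rightarrow> nat) \<Rightarrow> real) \<Rightarrow> real vec set" where
  "pure_harmonic_games n k w =
     vec_module.orthogonal_complement (n * num_profiles n k) (potential_games n k w)"


section \<open>The matrices \<open>\<Lambda>\<^sub>i\<close> and the columns of \<open>B\<close>\<close>

definition E_mat :: "nat \<Rightarrow> (nat \<Rightarrow> nat) \<Rightarrow> nat \<Rightarrow> real mat" where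
  "E_mat n k i = 1\<^sub>m (\<Prod>j\<in>{1..<i}. k j) \<otimes>\<^sub>m mat (k i) 1 (\<lambda>_. 1) \<otimes>\<^sub>m 1\<^sub>m (\<Prod>j\<in>{i<..n}. k j)"

definition weight_vec ::
  "nat \<Rightarrow> (nat \<Rightarrow> nat) \<Rightarrow> (nat \<Rightarrow> (nat \<Rightarrow> nat) \<Rightarrow> real) \<Rightarrow> nat \<Rightarrow> real vec" where
  "weight_vec n k w i = structure_vec k (removeAll i [1..<Suc n]) (w i)"

definition Lambda_mat ::
  "nat \<Rightarrow> (nat \<Rightarrow> nat) \<Rightarrow> (nat \<Rightarrow> (nat \<Rightarrow> nat) \<Rightarrow> real) \<Rightarrow> nat \<Rightarrow> real mat" where
  "Lambda_mat n k w i = mat_diag (num_profiles n k)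
     (\<lambda>l. (mat_of_row (weight_vec n k w i) * transpose_mat (E_mat n k i)) $$ (0, l))"

text \<open>Block \<open>p\<close> of the column of \<open>J\<^sub>r\<close> with parameters \<open>(\<iota> 1, \<dots>, \<iota> n)\<close>.\<close>

definition J_block :: "nat \<Rightarrow> (nat \<Rightarrow> nat) \<Rightarrow> (nat \<Rightarrow> (nat \<Rightarrow> nat) \<Rightarrow> real) \<Rightarrow> nat \<Rightarrow> (nat \<Rightarrow> nat)
    \<Rightarrow> nat \<Rightarrow> real vec" where
  "J_block n k w r \<iota> p =
    (if p \<le> r then
       the (mat_inverse (Lambda_mat n k w p)) *\<^sub>v kron_list (map (\<lambda>q.
         if q < p then delta (k q) (\<iota> q)
         else if q = p then delta (k q) 1 - delta (k q) (\<iota> q)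
         else if q \<le> r then delta (k q) 1
         else if q = Suc r then delta (k q) 1 - delta (k q) (\<iota> q)
         else delta (k q) (\<iota> q)) [1..<Suc n])
     else if p = Suc r then
       - (the (mat_inverse (Lambda_mat n k w p)) *\<^sub>v
           ((kron_list (map (\<lambda>q. delta (k q) 1) [1..<Suc r])
               - kron_list (map (\<lambda>q. delta (k q) (\<iota> q)) [1..<Suc r]))
             \<otimes>\<^sub>v (delta (k (Suc r)) 1 - delta (k (Suc r)) (\<iota> (Suc r)))
             \<otimes>\<^sub>v kron_list (map (\<lambda>q. delta (k q) (\<iota> q)) [Suc (Suc r)..<Suc n])))
     else 0\<^sub>v (num_profiles n k))"

definition J_col :: "nat \<Rightarrow> (nat \<Rightarrow> nat) \<Rightarrow> (nat \<Rightarrow> (nat \<Rightarrow> nat) \<Rightarrow> real) \<Rightarrow> nat \<Rightarrow> (nat \<Rightarrow> nat)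
    \<Rightarrow> real vec" where
  "J_col n k w r \<iota> = concat_vec (map (J_block n k w r \<iota>) [1..<Suc n])"

text \<open>The parameter tuples are enumerated in lexicographic order; each admissible tuple contributes
  exactly one column. In the filter, \<open>is ! r\<close> is the component with number \<open>r + 1\<close>.\<close>

definition J_cols :: "nat \<Rightarrow> (nat \<Rightarrow> nat) \<Rightarrow> (nat \<Rightarrow> (nat \<Rightarrow> nat) \<Rightarrow> real) \<Rightarrow> nat \<Rightarrow> real vec list" where
  "J_cols n k w r = map (\<lambda>is. J_col n k w r (\<lambda>p. is ! (p - 1)))
     (filter (\<lambda>is. is ! r \<noteq> 1 \<and> take r is \<noteq> replicate r 1)
       (product_lists (map (\<lambda>p. [1..<Suc (k p)]) [1..<Suc n])))"

definition B_mat :: "nat \<Rightarrow> (nat \<Rightarrow> nat) \<Rightarrow> (nat \<Rightarrow> (nat \<Rightarrow> nat) \<Rightarrow> real) \<Rightarrow> real mat" where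
  "B_mat n k w = mat_of_cols (n * num_profiles n k) (concat (map (J_cols n k w) [1..<n]))"


section \<open>Existence and uniqueness of the structure vector\<close>

primrec profile_index :: "(nat \<Rightarrow> nat) \<Rightarrow> nat list \<Rightarrow> (nat \<Rightarrow> nat) \<Rightarrow> nat" where
  "profile_index k [] s = 0"
| "profile_index k (j # js) s = (s j - 1) * (\<Prod>j\<in>set js. k j) + profile_index k js s"

lemma kron_vec_unit_vec:
  assumes "a < m" "b < l"
  shows "unit_vec m a \<otimes>\<^sub>v unit_vec l b = unit_vec (m * l) (a * l + b)"
proof (rule eq_vecI)
  fix t assume "t < dim_vec (unit_vec (m * l) (a * l + b) :: real vec)"
  then have t: "t < m * l" by simp
  then have l: "0 < l" by (cases l) auto
  have "t div l < m" using t l by (simp add: less_mult_imp_div_less)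
  moreover have "t mod l < l" using l by simp
  moreover have "(t = a * l + b) = (t div l = a \<and> t mod l = b)"
    using assms l by (metis div_mult_mod_eq div_mult_self3 mod_mult_self3 div_less mod_less
        add.right_neutral less_nat_zero_code add.commute add_0)
  moreover have "a * l + b < m * l"
  proof -
    have "a * l + b < Suc a * l" using assms by simp
    also have "\<dots> \<le> m * l" using assms by (intro mult_le_mono1) simp
    finally show ?thesis .
  qed
  ultimately show "(unit_vec m a \<otimes>\<^sub>v unit_vec l b) $ t = unit_vec (m * l) (a * l + b) $ t"
    using t assms by (auto simp: kron_vec_def unit_vec_def)
qed (simp add: kron_vec_def)

lemma profile_index_less:
  assumes "distinct js" "\<forall>j\<in>set js. 1 \<le> s j \<and> s j \<le> k j"
  shows "profile_index k js s < (\<Prod>j\<in>set js. k j)"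
  using assms
proof (induction js)
  case (Cons a js)
  let ?K = "\<Prod>j\<in>set js. k j"
  have "profile_index k (a # js) s < (s a - 1) * ?K + ?K" using Cons by simp
  also have "\<dots> = s a * ?K" using Cons.prems by (cases "s a") auto
  also have "\<dots> \<le> k a * ?K" using Cons.prems by (intro mult_le_mono1) simp
  finally show ?case using Cons.prems by simp
qed simp

lemma kron_list_delta:
  assumes "distinct js" "\<forall>j\<in>set js. 1 \<le> s j \<and> s j \<le> k j"
  shows "kron_list (map (\<lambda>j. delta (k j) (s j)) js)
    = unit_vec (\<Prod>j\<in>set js. k j) (profile_index k js s)"
  using assms
proof (induction js)
  case Nil
  show ?case by (auto simp: kron_list_def unit_vec_def)
next
  case (Cons a js)
  have "s a - 1 < k a" using Cons.prems by (auto simp: less_diff_conv2 le_imp_less_Suc)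
  moreover have "profile_index k js s < (\<Prod>j\<in>set js. k j)"
    using Cons.prems by (intro profile_index_less) auto
  ultimately show ?case
    using Cons kron_vec_unit_vec by (simp add: kron_list_def delta_def)
qed

lemma profile_index_inj:
  assumes "distinct js" "\<forall>j\<in>set js. 1 \<le> s j \<and> s j \<le> k j" "\<forall>j\<in>set js. 1 \<le> t j \<and> t j \<le> k j"
    and "profile_index k js s = profile_index k js t" "j \<in> set js"
  shows "s j = t j"
  using assms
proof (induction js)
  case (Cons a js)
  let ?K = "\<Prod>j\<in>set js. k j"
  have ls: "profile_index k js s < ?K" using Cons.prems by (intro profile_index_less) auto
  have lt: "profile_index k js t < ?K" using Cons.prems by (intro profile_index_less) auto
  have eq: "(s a - 1) * ?K + profile_index k js s = (t a - 1) * ?K + profile_index k js t"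
    using Cons.prems by simp
  have "s a - 1 = t a - 1"
    using arg_cong[OF eq, of "\<lambda>x. x div ?K"] ls lt
    by (metis add.right_neutral add_diff_cancel_left' div_less div_mult_self3 gr_zeroI
        less_nat_zero_code)
  moreover have "1 \<le> s a" "1 \<le> t a" using Cons.prems by auto
  ultimately have "s a = t a" by linarith
  moreover have "profile_index k js s = profile_index k js t" using eq \<open>s a - 1 = t a - 1\<close> by simp
  ultimately show ?case using Cons by auto
qed simp

lemma profile_index_bij:
  assumes "distinct js"
  shows "bij_betw (profile_index k js) (profiles k (set js)) {..<\<Prod>j\<in>set js. k j}"
proof -
  have range: "\<forall>j\<in>set js. 1 \<le> s j \<and> s j \<le> k j" if "s \<in> profiles k (set js)" for s
    using that by (auto simp: profiles_def PiE_iff)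
  have inj: "inj_on (profile_index k js) (profiles k (set js))"
  proof (rule inj_onI)
    fix s t assume st: "s \<in> profiles k (set js)" "t \<in> profiles k (set js)"
      and "profile_index k js s = profile_index k js t"
    then have "s j = t j" if "j \<in> set js" for j
      using profile_index_inj[OF assms range[OF st(1)] range[OF st(2)]] that by blast
    then show "s = t" using st unfolding profiles_def by (auto intro: PiE_ext)
  qed
  moreover have "card (profiles k (set js)) = (\<Prod>j\<in>set js. k j)"
    by (simp add: profiles_def card_PiE)
  moreover have "profile_index k js ` profiles k (set js) \<subseteq> {..<\<Prod>j\<in>set js. k j}"
    using profile_index_less[OF assms] range by auto
  ultimately have "profile_index k js ` profiles k (set js) = {..<\<Prod>j\<in>set js. k j}"
    by (intro card_subset_eq) (auto simp: card_image)
  then show ?thesis using inj by (simp add: bij_betw_def)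
qed

lemma structure_vec_ex1:
  assumes "distinct js"
  shows "\<exists>!V. V \<in> carrier_vec (\<Prod>j\<in>set js. k j) \<and>
    (\<forall>s\<in>profiles k (set js). f s = V \<bullet> kron_list (map (\<lambda>j. delta (k j) (s j)) js))"
proof -
  let ?K = "\<Prod>j\<in>set js. k j" and ?S = "profiles k (set js)"
  let ?x = "\<lambda>s. kron_list (map (\<lambda>j. delta (k j) (s j)) js)"
  let ?V = "vec ?K (\<lambda>l. f (the_inv_into ?S (profile_index k js) l))"
  note bij = profile_index_bij[OF assms, of k]
  have entry: "V \<bullet> ?x s = V $ profile_index k js s" if "V \<in> carrier_vec ?K" "s \<in> ?S" for V s
  proof -
    have "?x s = unit_vec ?K (profile_index k js s)"
      using that by (intro kron_list_delta assms) (auto simp: profiles_def PiE_iff)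
    moreover have "profile_index k js s < ?K" using bij that by (auto simp: bij_betw_def)
    ultimately show ?thesis using that by (simp add: scalar_prod_right_unit)
  qed
  show ?thesis
  proof (rule ex1I)
    have "f s = ?V \<bullet> ?x s" if s: "s \<in> ?S" for s
    proof -
      have "profile_index k js s < ?K" using bij s by (auto simp: bij_betw_def)
      moreover have "the_inv_into ?S (profile_index k js) (profile_index k js s) = s"
        using bij s by (intro the_inv_into_f_f) (auto simp: bij_betw_def)
      ultimately show ?thesis using entry[OF _ s, of ?V] by simp
    qed
    then show "?V \<in> carrier_vec ?K \<and> (\<forall>s\<in>?S. f s = ?V \<bullet> ?x s)" by simp
  next
    fix V assume V: "V \<in> carrier_vec ?K \<and> (\<forall>s\<in>?S. f s = V \<bullet> ?x s)"
    show "V = ?V"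
    proof (rule eq_vecI)
      fix l assume "l < dim_vec ?V"
      then have "l \<in> profile_index k js ` ?S" using bij by (simp add: bij_betw_def)
      then obtain s where s: "s \<in> ?S" "l = profile_index k js s" by blast
      moreover have "the_inv_into ?S (profile_index k js) (profile_index k js s) = s"
        using bij s by (intro the_inv_into_f_f) (auto simp: bij_betw_def)
      ultimately show "V $ l = ?V $ l" using V entry[of V s] \<open>l < dim_vec ?V\<close> by simp
    qed (use V in simp)
  qed
qed

end

theory Submission
  imports Defs
begin

text \<open>A coset weighted potential game has \<open>c\<^sub>i(s) = w\<^sub>i(s\<^bsub>-i\<^esub>) P(s) + d\<^sub>i(s\<^bsub>-i\<^esub>)\<close> with arbitrary
  \<open>P\<close> and \<open>d\<^sub>i\<close>, so \<open>h\<close> is orthogonal to all of them iff \<open>g\<^sub>i = w\<^sub>i h\<^sub>i\<close> satisfies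
  \<open>\<Sum>\<^sub>x g\<^sub>i(x, s\<^bsub>-i\<^esub>) = 0\<close> and \<open>\<Sum>\<^sub>i g\<^sub>i(s) = 0\<close>. Multiplication by \<open>\<Lambda>\<^sub>i\<close> thus removes the weights
  altogether. The columns satisfy the two identities, the second one by telescoping. Conversely let
  \<open>r + 1\<close> be the last player with \<open>g\<^bsub>r+1\<^esub> \<noteq> 0\<close>: in block \<open>r + 1\<close> the columns of \<open>J\<^sub>r\<close> form minus an
  identity matrix at the profiles \<open>s\<close> with \<open>s\<^bsub>r+1\<^esub> \<noteq> 1\<close> and \<open>(s\<^sub>1, \<dots>, s\<^sub>r) \<noteq> (1, \<dots>, 1)\<close>, so a unique
  combination of them clears these entries, and the two identities then force the whole block to
  vanish. Induction on \<open>r\<close> gives spanning; independence follows from the same triangular shape.\<close>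

section \<open>Injective matrices\<close>

text \<open>Two equal columns i \<noteq> j would put the difference of the unit vectors i and j into
  the kernel. Distinctness has to be recorded because a basis is a set, in which a repeated column
  would go unnoticed.\<close>

lemma (in vec_space) inj_mat_distinct_cols:
  assumes A: "(A :: 'a mat) \<in> carrier_mat n nc"
    and inj: "\<And>v. v \<in> carrier_vec nc \<Longrightarrow> A *\<^sub>v v = 0\<^sub>v n \<Longrightarrow> v = 0\<^sub>v nc"
  shows "distinct (cols A)"
  unfolding distinct_conv_nth
proof (intro allI impI notI)
  fix i j assume ij: "i < length (cols A)" "j < length (cols A)" "i \<noteq> j" "cols A ! i = cols A ! j"
  then have i: "i < nc" and j: "j < nc" and eq: "col A i = col A j" using A by auto
  let ?v = "unit_vec nc i - unit_vec nc j :: 'a vec"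
  have "A *\<^sub>v ?v = A *\<^sub>v unit_vec nc i - A *\<^sub>v unit_vec nc j"
    using A by (intro mult_minus_distrib_mat_vec) auto
  also have "\<dots> = 0\<^sub>v n"
  proof (rule eq_vecI)
    fix l assume l: "l < dim_vec (0\<^sub>v n :: 'a vec)"
    then have "(A *\<^sub>v unit_vec nc i - A *\<^sub>v unit_vec nc j) $ l = col A i $ l - col A j $ l"
      using A i j by (auto simp: scalar_prod_right_unit)
    then show "(A *\<^sub>v unit_vec nc i - A *\<^sub>v unit_vec nc j) $ l = 0\<^sub>v n $ l" using eq l by simp
  qed (use A in auto)
  finally have "?v = 0\<^sub>v nc" by (intro inj) auto
  then have "?v $ i = 0\<^sub>v nc $ i" by simp
  then show False using i j ij(3) by simp
qed

text \<open>As no column repeats, a dependence with coefficients \<open>a\<close> on the set of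
  columns is a kernel vector of \<open>A\<close> with entries \<open>a (col A i)\<close>.\<close>

lemma (in vec_space) inj_mat_lin_indpt_cols:
  assumes A: "(A :: 'a mat) \<in> carrier_mat n nc"
    and inj: "\<And>v. v \<in> carrier_vec nc \<Longrightarrow> A *\<^sub>v v = 0\<^sub>v n \<Longrightarrow> v = 0\<^sub>v nc"
  shows "lin_indpt (set (cols A))"
proof
  assume "lin_dep (set (cols A))"
  moreover have "set (cols A) \<subseteq> carrier_vec n" using A cols_dim by blast
  ultimately obtain a v where av: "lincomb a (set (cols A)) = 0\<^sub>v n" "v \<in> set (cols A)" "a v \<noteq> 0"
    using finite_lin_dep[of "set (cols A)"] by auto
  have "A *\<^sub>v vec nc (\<lambda>i. a (col A i)) = 0\<^sub>v n"
    using mat_mult_eq_lincomb[OF A inj_mat_distinct_cols[OF A inj], of a] av(1) by simp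
  then have *: "vec nc (\<lambda>i. a (col A i)) = 0\<^sub>v nc" by (intro inj) auto
  obtain i where "i < nc" "v = col A i" using av(2) A by (auto simp: in_set_conv_nth)
  then show False using arg_cong[OF *, of "\<lambda>v. v $ i"] av(3) by simp
qed

text \<open>Independence must be moved from the ambient space to the column space regarded as a
  vector space of its own; \<open>span_li_not_depend\<close> does this.\<close>

lemma (in vec_space) inj_mat_cols_basis:
  assumes A: "(A :: 'a mat) \<in> carrier_mat n nc"
    and inj: "\<And>v. v \<in> carrier_vec nc \<Longrightarrow> A *\<^sub>v v = 0\<^sub>v n \<Longrightarrow> v = 0\<^sub>v nc"
  shows "rank A = nc" "vectorspace.basis class_ring (vs (col_space A)) (set (cols A))"
proof -
  have li: "lin_indpt (set (cols A))" using inj_mat_lin_indpt_cols[OF A inj] .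
  show "rank A = nc" using lin_indpt_full_rank[OF A inj_mat_distinct_cols[OF A inj] li] .
  have car: "set (cols A) \<subseteq> carrier_vec n" using A cols_dim by blast
  have vsp: "vectorspace class_ring (span_vs (set (cols A)))"
    using car span_is_subspace subspace_def subspace_is_vs by simp
  have sub: "set (cols A) \<subseteq> span (set (cols A))" using car in_own_span by simp
  have subm: "submodule class_ring (span (set (cols A))) V" using car span_is_submodule by simp
  show "vectorspace.basis class_ring (vs (col_space A)) (set (cols A))"
    unfolding col_space_def vectorspace.basis_def[OF vsp]
    using span_li_not_depend[OF sub subm] li sub by simp
qed


section \<open>The unweighted harmonic equations\<close>

lemma finite_profiles [simp]: "finite J \<Longrightarrow> finite (profiles k J)"
  by (simp add: profiles_def finite_PiE)

lemma profiles_range: "s \<in> profiles k J \<Longrightarrow> j \<in> J \<Longrightarrow> 1 \<le> s j \<and> s j \<le> k j"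
  by (auto simp: profiles_def PiE_iff)

lemma profiles_ext:
  "s \<in> profiles k J \<Longrightarrow> t \<in> profiles k J \<Longrightarrow> (\<And>j. j \<in> J \<Longrightarrow> s j = t j) \<Longrightarrow> s = t"
  unfolding profiles_def by (rule PiE_ext)

lemma profiles_upd: "s \<in> profiles k J \<Longrightarrow> i \<in> J \<Longrightarrow> x \<in> {1..k i} \<Longrightarrow> s(i := x) \<in> profiles k J"
  by (auto simp: profiles_def PiE_iff extensional_def)

lemma profiles_minus_upd:
  "s \<in> profiles k (J - {i}) \<Longrightarrow> i \<in> J \<Longrightarrow> x \<in> {1..k i} \<Longrightarrow> s(i := x) \<in> profiles k J"
  by (auto simp: profiles_def PiE_iff extensional_def)

text \<open>Profiles are \<open>undefined\<close> outside their player set, so writing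
  \<open>undefined\<close> at i leaves the profile of the opponents of i. Throughout,
  \<open>w i (s(i := undefined))\<close> is the weight of player i at s.\<close>

lemma profiles_del: "s \<in> profiles k J \<Longrightarrow> s(i := undefined) \<in> profiles k (J - {i})"
  by (auto simp: profiles_def PiE_iff extensional_def)

lemma profiles_minus_undefined: "s \<in> profiles k (J - {i}) \<Longrightarrow> s(i := undefined) = s"
  by (auto simp: profiles_def PiE_iff extensional_def)

text \<open>Fubini along the bijection (x, s) \<mapsto> s(i := x): the value at i gives back x, and
  erasing coordinate i gives back s.\<close>

lemma sum_profiles_coord:
  fixes f :: "(nat \<Rightarrow> nat) \<Rightarrow> real"
  assumes "finite J" "i \<in> J"
  shows "(\<Sum>s\<in>profiles k J. f s) = (\<Sum>s\<in>profiles k (J - {i}). \<Sum>x\<in>{1..k i}. f (s(i := x)))"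
proof -
  have J: "J = insert i (J - {i})" using assms by auto
  have eq: "profiles k J = (\<lambda>(x, s). s(i := x)) ` ({1..k i} \<times> profiles k (J - {i}))"
    unfolding profiles_def by (subst J, subst PiE_insert_eq) simp
  have inj: "inj_on (\<lambda>(x, s). s(i := x)) ({1..k i} \<times> profiles k (J - {i}))"
  proof (rule inj_onI, clarsimp)
    fix x s y t assume s: "s \<in> profiles k (J - {i})" and t: "t \<in> profiles k (J - {i})"
      and e: "s(i := x) = t(i := y)"
    have "x = y" using fun_cong[OF e, of i] by simp
    moreover have "s = t"
      using s t arg_cong[OF e, of "\<lambda>f. f(i := undefined)"] profiles_minus_undefined by auto
    ultimately show "x = y \<and> s = t" by simp
  qed
  show ?thesis
    unfolding eq sum.reindex[OF inj] by (subst sum.swap) (simp add: sum.cartesian_product case_prod_unfold o_def)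
qed

text \<open>The column of \<open>J\<^sub>r\<close> with parameters \<open>\<iota>\<close>, as a function of the player \<open>p\<close> and the profile \<open>s\<close>
  and without the factors \<open>\<Lambda>\<^sub>p\<^sup>-\<^sup>1\<close>.\<close>

definition J_fun :: "nat \<Rightarrow> nat \<Rightarrow> (nat \<Rightarrow> nat) \<Rightarrow> nat \<Rightarrow> (nat \<Rightarrow> nat) \<Rightarrow> real" where
  "J_fun n r \<iota> p s =
    (if p \<le> r then
       (\<Prod>q\<in>{1..<p}. of_bool (s q = \<iota> q)) * (of_bool (s p = 1) - of_bool (s p = \<iota> p))
         * (\<Prod>q\<in>{p<..r}. of_bool (s q = 1))
     else if p = Suc r then
       (\<Prod>q\<in>{1..r}. of_bool (s q = \<iota> q)) - (\<Prod>q\<in>{1..r}. of_bool (s q = 1))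
     else 0)
    * (of_bool (s (Suc r) = 1) - of_bool (s (Suc r) = \<iota> (Suc r)))
    * (\<Prod>q\<in>{Suc r<..n}. of_bool (s q = \<iota> q))"

text \<open>These tuples parametrize the columns of family r. Read as profiles, they are also the
  entries of block r + 1 on which those columns are diagonal.\<close>

definition J_index :: "nat \<Rightarrow> (nat \<Rightarrow> nat) \<Rightarrow> nat \<Rightarrow> (nat \<Rightarrow> nat) set" where
  "J_index n k r = {\<iota> \<in> profiles k {1..n}. \<iota> (Suc r) \<noteq> 1 \<and> (\<exists>q\<in>{1..r}. \<iota> q \<noteq> 1)}"

lemma finite_J_index [simp]: "finite (J_index n k r)"
  by (simp add: J_index_def)

text \<open>No player precedes player 1, so r = 0 yields no column. Sums may therefore run over all
  r < n although the families start at r = 1.\<close>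

lemma J_index_0 [simp]: "J_index n k 0 = {}"
  by (auto simp: J_index_def)

section \<open>The unweighted columns satisfy both harmonic identities\<close>

lemma sum_point_difference:
  fixes a b m :: nat
  assumes "a \<in> {1..m}" "b \<in> {1..m}"
  shows "(\<Sum>x\<in>{1..m}. of_bool (x = a) - of_bool (x = b) :: real) = 0"
proof -
  have *: "(\<Sum>x\<in>{1..m}. of_bool (x = c) :: real) = 1" if "c \<in> {1..m}" for c
    using that by (simp add: of_bool_def sum.delta)
  show ?thesis unfolding sum_subtractf using *[OF assms(1)] *[OF assms(2)] by simp
qed

text \<open>As a function of the strategy of player i, block i is the difference of the point masses
  at 1 and \<open>\<iota> i\<close>, times a cofactor free of this strategy; both point masses have
  total mass 1.\<close>

lemma J_fun_sum_strategies:
  assumes "\<iota> \<in> profiles k {1..n}" "i \<in> {1..n}" "r < n"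
  shows "(\<Sum>x\<in>{1..k i}. J_fun n r \<iota> i (s(i := x))) = 0"
proof -
  have "1 \<le> \<iota> i \<and> \<iota> i \<le> k i" using assms by (intro profiles_range) auto
  then have D: "(\<Sum>x\<in>{1..k i}. of_bool (x = 1) - of_bool (x = \<iota> i) :: real) = 0"
    by (intro sum_point_difference) auto
  have "\<exists>c. \<forall>x. J_fun n r \<iota> i (s(i := x)) = (of_bool (x = 1) - of_bool (x = \<iota> i)) * c"
  proof -
    consider "i \<le> r" | "i = Suc r" | "i > Suc r" by linarith
    then show ?thesis
    proof cases
      case 1
      then show ?thesis
        by (intro exI[of _ "(\<Prod>q\<in>{1..<i}. of_bool (s q = \<iota> q)) * (\<Prod>q\<in>{i<..r}. of_bool (s q = 1))
          * ((of_bool (s (Suc r) = 1) - of_bool (s (Suc r) = \<iota> (Suc r)))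
          * (\<Prod>q\<in>{Suc r<..n}. of_bool (s q = \<iota> q)))"])
          (simp add: J_fun_def mult_ac)
    next
      case 2
      then show ?thesis
        by (intro exI[of _ "((\<Prod>q\<in>{1..r}. of_bool (s q = \<iota> q)) - (\<Prod>q\<in>{1..r}. of_bool (s q = 1)))
          * (\<Prod>q\<in>{Suc r<..n}. of_bool (s q = \<iota> q))"])
          (simp add: J_fun_def mult_ac)
    next
      case 3
      then show ?thesis by (intro exI[of _ 0]) (simp add: J_fun_def)
    qed
  qed
  then obtain c where "\<And>x. J_fun n r \<iota> i (s(i := x)) = (of_bool (x = 1) - of_bool (x = \<iota> i)) * c"
    by blast
  then show ?thesis using D by (simp add: sum_distrib_right[symmetric])
qed

text \<open>Term p is the product with factors a before p and b from p on, minus the product with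
  factors a up to p and b after p. Consecutive terms cancel.\<close>

lemma sum_prod_telescope:
  fixes a b :: "nat \<Rightarrow> real"
  shows "(\<Sum>p\<in>{1..r}. (\<Prod>q\<in>{1..<p}. a q) * (b p - a p) * (\<Prod>q\<in>{p<..r}. b q))
    = (\<Prod>q\<in>{1..r}. b q) - (\<Prod>q\<in>{1..r}. a q)"
proof (induction r)
  case (Suc r)
  have *: "(\<Prod>q\<in>{p<..Suc r}. b q) = (\<Prod>q\<in>{p<..r}. b q) * b (Suc r)" if "p \<in> {1..r}" for p
  proof -
    have "{p<..Suc r} = insert (Suc r) {p<..r}" using that by auto
    then show ?thesis by simp
  qed
  have "(\<Sum>p\<in>{1..r}. (\<Prod>q\<in>{1..<p}. a q) * (b p - a p) * (\<Prod>q\<in>{p<..Suc r}. b q))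
     = (\<Sum>p\<in>{1..r}. (\<Prod>q\<in>{1..<p}. a q) * (b p - a p) * (\<Prod>q\<in>{p<..r}. b q)) * b (Suc r)"
    unfolding sum_distrib_right by (intro sum.cong refl) (simp add: *)
  then have "(\<Sum>p\<in>{1..r}. (\<Prod>q\<in>{1..<p}. a q) * (b p - a p) * (\<Prod>q\<in>{p<..Suc r}. b q))
     = ((\<Prod>q\<in>{1..r}. b q) - (\<Prod>q\<in>{1..r}. a q)) * b (Suc r)" unfolding Suc.IH .
  then show ?case by (simp add: atLeastLessThanSuc_atLeastAtMost algebra_simps)
qed simp

text \<open>With a the indicators of \<iota> and b the indicators of 1, the blocks 1 to r telescope
  to a difference of two products, which block r + 1 carries with the opposite sign. The factors of
  the players after r are common to all these blocks.\<close>

lemma J_fun_sum_players: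
  assumes "r < n"
  shows "(\<Sum>p\<in>{1..n}. J_fun n r \<iota> p s) = 0"
proof -
  have "(\<Sum>p\<in>{1..n}. J_fun n r \<iota> p s) = (\<Sum>p\<in>{1..Suc r}. J_fun n r \<iota> p s)"
    using assms by (intro sum.mono_neutral_right) (auto simp: J_fun_def)
  also have "\<dots> = (\<Sum>p\<in>{1..r}. J_fun n r \<iota> p s) + J_fun n r \<iota> (Suc r) s" by simp
  also have "(\<Sum>p\<in>{1..r}. J_fun n r \<iota> p s)
    = (\<Sum>p\<in>{1..r}. (\<Prod>q\<in>{1..<p}. of_bool (s q = \<iota> q)) * (of_bool (s p = 1) - of_bool (s p = \<iota> p))
         * (\<Prod>q\<in>{p<..r}. of_bool (s q = 1)))
      * ((of_bool (s (Suc r) = 1) - of_bool (s (Suc r) = \<iota> (Suc r)))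
      * (\<Prod>q\<in>{Suc r<..n}. of_bool (s q = \<iota> q)))"
    unfolding sum_distrib_right by (intro sum.cong refl) (simp add: J_fun_def mult_ac)
  also have "\<dots> + J_fun n r \<iota> (Suc r) s = 0"
    unfolding sum_prod_telescope by (simp add: J_fun_def algebra_simps)
  finally show ?thesis .
qed

section \<open>Triangular shape of the unweighted columns: independence and spanning\<close>

lemma prod_of_bool:
  "finite A \<Longrightarrow> (\<Prod>q\<in>A. of_bool (P q) :: real) = of_bool (\<forall>q\<in>A. P q)"
  by (induction A rule: finite_induct) auto

text \<open>The block \<open>r + 1\<close> of the columns of \<open>J\<^sub>r\<close>, restricted to the entries indexed by \<open>J_index n k r\<close>,
  is minus the identity matrix; this is the triangularity behind both spanning and independence.\<close>

lemma J_fun_diagonal: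
  assumes "r < n" "\<iota> \<in> J_index n k r" "s \<in> J_index n k r"
  shows "J_fun n r \<iota> (Suc r) s = - of_bool (s = \<iota>)"
proof -
  have "(s = \<iota>) = (\<forall>q\<in>{1..n}. s q = \<iota> q)"
    using assms unfolding J_index_def profiles_def by (auto intro: PiE_ext)
  also have "{1..n} = {1..r} \<union> {Suc r} \<union> {Suc r<..n}" using assms(1) by auto
  finally have "(s = \<iota>) = ((\<forall>q\<in>{1..r}. s q = \<iota> q) \<and> s (Suc r) = \<iota> (Suc r) \<and> (\<forall>q\<in>{Suc r<..n}. s q = \<iota> q))"
    by blast
  \<comment> \<open>At such s the indicators of 1 drop out of both differences, and the product of
    what remains is minus the indicator of s = \<iota>.\<close>
  moreover have "\<not> (\<forall>q\<in>{1..r}. s q = 1)" "s (Suc r) \<noteq> 1"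
    using assms by (auto simp: J_index_def)
  ultimately show ?thesis
    unfolding J_fun_def prod_of_bool[OF finite_greaterThanAtMost] prod_of_bool[OF finite_atLeastAtMost]
    by (simp add: of_bool_conj)
qed

text \<open>Descending induction on r, evaluating the relation at player r + 1 and profile \<iota>:
  families r' < r are zero in block r + 1, families r' > r have zero coefficients by induction, and
  the diagonal of family r leaves \<open>- a r \<iota>\<close>.\<close>

lemma J_fun_independent:
  assumes zero: "\<And>p s. p \<in> {1..n} \<Longrightarrow> s \<in> profiles k {1..n} \<Longrightarrow>
      (\<Sum>r<n. \<Sum>\<iota>\<in>J_index n k r. a r \<iota> * J_fun n r \<iota> p s) = 0"
    and "r < n" "\<iota> \<in> J_index n k r"
  shows "a r \<iota> = 0"
  using assms(2,3)
proof (induction "n - r" arbitrary: r \<iota> rule: less_induct)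
  case less
  have s: "\<iota> \<in> profiles k {1..n}" using less.prems by (simp add: J_index_def)
  have "(\<Sum>\<iota>'\<in>J_index n k r'. a r' \<iota>' * J_fun n r' \<iota>' (Suc r) \<iota>) = 0" if "r' \<in> {..<n} - {r}" for r'
  proof (cases "r' < r")
    case True
    then show ?thesis by (intro sum.neutral) (simp add: J_fun_def)
  next
    case False
    then have "n - r' < n - r" "r' < n" using that less.prems by auto
    then show ?thesis using less.hyps by (intro sum.neutral) auto
  qed
  then have "(\<Sum>r'<n. \<Sum>\<iota>'\<in>J_index n k r'. a r' \<iota>' * J_fun n r' \<iota>' (Suc r) \<iota>)
    = (\<Sum>\<iota>'\<in>J_index n k r. a r \<iota>' * J_fun n r \<iota>' (Suc r) \<iota>)"
    using less.prems by (subst sum.remove[of _ r]) auto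
  also have "\<dots> = (\<Sum>\<iota>'\<in>J_index n k r. if \<iota> = \<iota>' then - a r \<iota>' else 0)"
    using less.prems by (intro sum.cong refl) (simp add: J_fun_diagonal)
  also have "\<dots> = - a r \<iota>" using less.prems by simp
  finally show ?case using zero[OF _ s, of "Suc r"] less.prems by simp
qed

lemma override_on_profiles:
  assumes "s \<in> profiles k J" "t \<in> profiles k I" "I \<subseteq> J"
  shows "override_on s t I \<in> profiles k J"
  using assms by (auto simp: profiles_def PiE_iff extensional_def override_on_def)

text \<open>Players outside \<open>I\<close> stay as in s while those in \<open>I\<close> run
  through all strategies; carrying out the sum over player i first already gives zero.\<close>

lemma sum_profiles_override:
  fixes f :: "(nat \<Rightarrow> nat) \<Rightarrow> real"
  assumes "finite I" "i \<in> I" "I \<subseteq> J" "s \<in> profiles k J" "1 \<le> k i"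
    and "\<And>u. u \<in> profiles k J \<Longrightarrow> (\<Sum>x\<in>{1..k i}. f (u(i := x))) = 0"
  shows "(\<Sum>t\<in>profiles k I. f (override_on s t I)) = 0"
proof -
  have "(\<Sum>t\<in>profiles k I. f (override_on s t I))
    = (\<Sum>t\<in>profiles k (I - {i}). \<Sum>x\<in>{1..k i}. f (override_on s (t(i := x)) I))"
    using assms by (intro sum_profiles_coord)
  \<comment> \<open>The strategy 1 at i is a placeholder overwritten by x; it makes the argument a
    full profile, as the assumption on \<open>f\<close> demands.\<close>
  also have "\<dots> = (\<Sum>t\<in>profiles k (I - {i}). \<Sum>x\<in>{1..k i}. f ((override_on s (t(i := 1)) I)(i := x)))"
    using assms(2) by (intro sum.cong refl arg_cong[where f = f]) (auto simp: override_on_def)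
  also have "\<dots> = 0"
    using assms by (intro sum.neutral ballI assms(6) override_on_profiles profiles_minus_upd) auto
  finally show ?thesis .
qed

text \<open>The number \<open>m\<close> bounds the last nonzero block, and each induction step
  removes one block. Only families r < m occur, since family r ends at block r + 1.\<close>

lemma J_fun_span:
  fixes g :: "nat \<Rightarrow> (nat \<Rightarrow> nat) \<Rightarrow> real"
  assumes k: "\<And>i. i \<in> {1..n} \<Longrightarrow> 1 \<le> k i"
    and "\<And>i s. i \<in> {1..n} \<Longrightarrow> s \<in> profiles k {1..n} \<Longrightarrow> (\<Sum>x\<in>{1..k i}. g i (s(i := x))) = 0"
    and "\<And>s. s \<in> profiles k {1..n} \<Longrightarrow> (\<Sum>i\<in>{1..n}. g i s) = 0"
    and "m \<le> n"
    and "\<And>p s. p \<in> {m<..n} \<Longrightarrow> s \<in> profiles k {1..n} \<Longrightarrow> g p s = 0"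
  shows "\<exists>a. \<forall>p\<in>{1..n}. \<forall>s\<in>profiles k {1..n}.
    g p s = (\<Sum>r<m. \<Sum>\<iota>\<in>J_index n k r. a r \<iota> * J_fun n r \<iota> p s)"
  using assms(2-)
proof (induction m arbitrary: g)
  case 0
  then show ?case by auto
next
  case (Suc r)
  note strat = Suc.prems(1) and play = Suc.prems(2) and zero = Suc.prems(4)
  have r: "r < n" using Suc.prems by simp
  let ?S = "profiles k {1..n}" and ?I = "J_index n k r" and ?R = "Suc r"
  \<comment> \<open>On \<open>?I\<close> block r + 1 of family r is minus the identity, so adding
    its columns with the entries of \<open>g\<close> as coefficients cancels these entries.\<close>
  define h where "h p s = g p s + (\<Sum>\<iota>\<in>?I. g ?R \<iota> * J_fun n r \<iota> p s)" for p s
  have IS: "\<iota> \<in> ?S" if "\<iota> \<in> ?I" for \<iota> using that by (simp add: J_index_def)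
  have h_strat: "(\<Sum>x\<in>{1..k i}. h i (s(i := x))) = 0" if "i \<in> {1..n}" "s \<in> ?S" for i s
  proof -
    have "(\<Sum>x\<in>{1..k i}. \<Sum>\<iota>\<in>?I. g ?R \<iota> * J_fun n r \<iota> i (s(i := x)))
      = (\<Sum>\<iota>\<in>?I. g ?R \<iota> * (\<Sum>x\<in>{1..k i}. J_fun n r \<iota> i (s(i := x))))"
      by (subst sum.swap) (simp add: sum_distrib_left)
    also have "\<dots> = 0"
      using J_fun_sum_strategies[OF IS that(1) r] by (intro sum.neutral) simp
    finally show ?thesis using strat[OF that] by (simp add: h_def sum.distrib fun_upd_def)
  qed
  have h_play: "(\<Sum>i\<in>{1..n}. h i s) = 0" if "s \<in> ?S" for s
  proof -
    have "(\<Sum>i\<in>{1..n}. \<Sum>\<iota>\<in>?I. g ?R \<iota> * J_fun n r \<iota> i s) = (\<Sum>\<iota>\<in>?I. g ?R \<iota> * (\<Sum>i\<in>{1..n}. J_fun n r \<iota> i s))"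
      by (subst sum.swap) (simp add: sum_distrib_left)
    also have "\<dots> = 0" using J_fun_sum_players[OF r] by simp
    finally show ?thesis using play[OF that] by (simp add: h_def sum.distrib)
  qed
  have h_above: "h p s = 0" if "p \<in> {?R<..n}" "s \<in> ?S" for p s
    using that zero[OF that] by (simp add: h_def J_fun_def)
  have h_index: "h ?R s = 0" if "s \<in> ?I" for s
  proof -
    have "(\<Sum>\<iota>\<in>?I. g ?R \<iota> * J_fun n r \<iota> ?R s) = (\<Sum>\<iota>\<in>?I. if s = \<iota> then - g ?R \<iota> else 0)"
      using that r by (intro sum.cong refl) (simp add: J_fun_diagonal)
    then show ?thesis using that by (simp add: h_def)
  qed
  \<comment> \<open>A profile with a nontrivial prefix but strategy 1 of player r + 1 lies outside
    \<open>?I\<close>. In the sum over the strategies of that player all other terms are already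
    zero, so this one is too.\<close>
  have h_off: "h ?R s = 0" if s: "s \<in> ?S" and ex: "\<exists>q\<in>{1..r}. s q \<noteq> 1" for s
  proof (cases "s ?R = 1")
    case True
    have "h ?R (s(?R := x)) = 0" if "x \<in> {1..k ?R} - {1}" for x
    proof (rule h_index)
      have "s(?R := x) \<in> ?S" using s that r by (intro profiles_upd) auto
      then show "s(?R := x) \<in> ?I" using that ex by (auto simp: J_index_def)
    qed
    moreover have "1 \<in> {1..k ?R}" using k[of ?R] r by simp
    ultimately have "(\<Sum>x\<in>{1..k ?R}. h ?R (s(?R := x))) = h ?R (s(?R := 1))"
      by (subst sum.remove[of _ 1]) auto
    moreover have "s(?R := 1) = s" using True by auto
    ultimately show ?thesis using h_strat[OF _ s, of ?R] r by simp
  next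
    case False
    then show ?thesis using s ex by (intro h_index) (simp add: J_index_def)
  qed
  \<comment> \<open>Entries of block \<open>r + 1\<close> with prefix \<open>(1, \<dots>, 1)\<close>: summing the players' identity over all
    prefixes kills the blocks \<open>1, \<dots>, r\<close>, and block \<open>r + 1\<close> is already known to vanish at the
    other prefixes.\<close>
  have h_R: "h ?R s = 0" if s: "s \<in> ?S" for s
  proof (cases "\<exists>q\<in>{1..r}. s q \<noteq> 1")
    case True
    then show ?thesis using h_off s by blast
  next
    case False
    let ?T = "profiles k {1..r}" and ?o = "\<lambda>t. override_on s t {1..r}" and ?u = "restrict s {1..r}"
    have sub: "{1..r} \<subseteq> {1..n}" using r by auto
    have o: "?o t \<in> ?S" if "t \<in> ?T" for t using override_on_profiles[OF s that sub] .
    have one: "?u \<in> ?T" "?o ?u = s"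
      using s r by (auto simp: profiles_def PiE_iff override_on_def)
    \<comment> \<open>For p \<le> r the sum of block p over all prefixes contains a full sum over
      the strategies of player p, hence is zero and may be added.\<close>
    have "(\<Sum>t\<in>?T. h ?R (?o t)) = (\<Sum>p\<in>{1..?R}. \<Sum>t\<in>?T. h p (?o t))"
    proof -
      have "(\<Sum>t\<in>?T. h p (?o t)) = 0" if "p \<in> {1..r}" for p
      proof (rule sum_profiles_override[where J = "{1..n}", OF _ that sub s])
        show "1 \<le> k p" using that r k by simp
        show "(\<Sum>x\<in>{1..k p}. h p (u(p := x))) = 0" if "u \<in> ?S" for u
          using that \<open>p \<in> {1..r}\<close> r by (intro h_strat) auto
      qed simp
      then show ?thesis by simp
    qed
    \<comment> \<open>The blocks above r + 1 vanish, so the range extends to all players and the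
      players' identity applies after exchanging the sums.\<close>
    also have "\<dots> = (\<Sum>p\<in>{1..n}. \<Sum>t\<in>?T. h p (?o t))"
      using r h_above o by (intro sum.mono_neutral_left ballI sum.neutral) auto
    also have "\<dots> = (\<Sum>t\<in>?T. \<Sum>p\<in>{1..n}. h p (?o t))" by (rule sum.swap)
    also have "\<dots> = 0" using h_play o by (intro sum.neutral) auto
    finally have "(\<Sum>t\<in>?T. h ?R (?o t)) = 0" .
    moreover have "(\<Sum>t\<in>?T. h ?R (?o t)) = h ?R (?o ?u) + (\<Sum>t\<in>?T - {?u}. h ?R (?o t))"
      using one by (intro sum.remove) auto
    \<comment> \<open>Here s has the prefix (1, ..., 1), so every t other than its restriction
      \<open>?u\<close> is a nontrivial prefix.\<close>
    moreover have "h ?R (?o t) = 0" if t: "t \<in> ?T - {?u}" for t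
    proof (rule h_off)
      show "?o t \<in> ?S" using t o by blast
      show "\<exists>q\<in>{1..r}. ?o t q \<noteq> 1"
      proof (rule ccontr)
        assume "\<not> ?thesis"
        then have "t q = ?u q" if "q \<in> {1..r}" for q using False that by auto
        then have "t = ?u" using t one(1) by (intro profiles_ext[of t k "{1..r}" ?u]) auto
        then show False using t by simp
      qed
    qed
    ultimately show ?thesis using one(2) by simp
  qed
  have "\<exists>a. \<forall>p\<in>{1..n}. \<forall>s\<in>?S. h p s = (\<Sum>r<r. \<Sum>\<iota>\<in>J_index n k r. a r \<iota> * J_fun n r \<iota> p s)"
  proof (rule Suc.IH)
    show "h p s = 0" if "p \<in> {r<..n}" "s \<in> ?S" for p s
      using that h_above h_R by (cases "p = ?R") auto
    show "(\<Sum>x\<in>{1..k i}. h i (s(i := x))) = 0" if "i \<in> {1..n}" "s \<in> ?S" for i s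
      using h_strat[OF that] .
    show "r \<le> n" using r by simp
  qed (rule h_play)
  then obtain a where a: "\<And>p s. p \<in> {1..n} \<Longrightarrow> s \<in> ?S \<Longrightarrow>
      h p s = (\<Sum>r<r. \<Sum>\<iota>\<in>J_index n k r. a r \<iota> * J_fun n r \<iota> p s)" by blast
  \<comment> \<open>The sign is negative since \<open>g\<close> is \<open>h\<close> minus the
    correction; the coefficients of the lower families come from the induction hypothesis.\<close>
  define b where "b = a(r := (\<lambda>\<iota>. - g ?R \<iota>))"
  have "g p s = (\<Sum>r<?R. \<Sum>\<iota>\<in>J_index n k r. b r \<iota> * J_fun n r \<iota> p s)"
    if "p \<in> {1..n}" "s \<in> ?S" for p s
  proof -
    have "g p s = h p s - (\<Sum>\<iota>\<in>?I. g ?R \<iota> * J_fun n r \<iota> p s)" by (simp add: h_def)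
    then show ?thesis using a[OF that] by (simp add: b_def sum_negf)
  qed
  then show ?case by blast
qed


section \<open>Entries of Kronecker products and structure vectors\<close>

lemma block_index_less:
  assumes "a < (m :: nat)" "b < l"
  shows "a * l + b < m * l"
proof -
  have "a * l + b < Suc a * l" using assms by simp
  also have "\<dots> \<le> m * l" using assms by (intro mult_le_mono1) simp
  finally show ?thesis .
qed

lemma block_index_div_mod:
  assumes "b < (l :: nat)"
  shows "(a * l + b) div l = a" "(a * l + b) mod l = b"
  using assms by auto

lemma kron_vec_index:
  assumes "a < dim_vec u" "b < dim_vec v"
  shows "(u \<otimes>\<^sub>v v) $ (a * dim_vec v + b) = u $ a * v $ b"
  using block_index_less[OF assms] assms by (simp add: kron_vec_def block_index_div_mod)

lemma kron_mat_index:
  assumes "a < dim_row A" "b < dim_row B" "c < dim_col A" "d < dim_col B"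
  shows "(A \<otimes>\<^sub>m B) $$ (a * dim_row B + b, c * dim_col B + d) = A $$ (a, c) * B $$ (b, d)"
  using block_index_less[OF assms(1,2)] block_index_less[OF assms(3,4)] assms
  by (simp add: kron_mat_def block_index_div_mod)

lemma dim_kron_vec [simp]: "dim_vec (u \<otimes>\<^sub>v v) = dim_vec u * dim_vec v"
  by (simp add: kron_vec_def)

lemma dim_delta [simp]: "dim_vec (delta m j) = m"
  by (simp add: delta_def)

lemma delta_index:
  assumes "1 \<le> x" "x \<le> m" "1 \<le> j"
  shows "delta m j $ (x - 1) = of_bool (x = j)"
  using assms by (auto simp: delta_def unit_vec_def)

lemma dim_kron_list:
  "distinct js \<Longrightarrow> (\<And>j. j \<in> set js \<Longrightarrow> dim_vec (u j) = k j) \<Longrightarrow>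
    dim_vec (kron_list (map u js)) = (\<Prod>j\<in>set js. k j)"
  by (induction js) (auto simp: kron_list_def)

text \<open>\<open>profile_index\<close> is the mixed-radix number with digits s j - 1, first player
  leading; quotient and remainder separate the Kronecker factors one after another.\<close>

lemma kron_list_index:
  assumes "distinct js" "\<And>j. j \<in> set js \<Longrightarrow> dim_vec (u j) = k j"
    and "\<And>j. j \<in> set js \<Longrightarrow> 1 \<le> s j \<and> s j \<le> k j"
  shows "kron_list (map u js) $ profile_index k js s = (\<Prod>j\<in>set js. u j $ (s j - 1))"
  using assms
proof (induction js)
  case (Cons a js)
  have d: "dim_vec (kron_list (map u js)) = (\<Prod>j\<in>set js. k j)"
    using Cons.prems by (intro dim_kron_list) auto
  have "profile_index k js s < (\<Prod>j\<in>set js. k j)"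
    using Cons.prems by (intro profile_index_less) auto
  moreover have "s a - 1 < dim_vec (u a)"
    using Cons.prems(2)[of a] Cons.prems(3)[of a] by (auto simp: less_eq_Suc_le)
  ultimately have "(u a \<otimes>\<^sub>v kron_list (map u js)) $ ((s a - 1) * (\<Prod>j\<in>set js. k j) + profile_index k js s)
      = u a $ (s a - 1) * kron_list (map u js) $ profile_index k js s"
    using kron_vec_index[of "s a - 1" "u a" "profile_index k js s" "kron_list (map u js)"] d by simp
  then show ?case using Cons by (simp add: kron_list_def)
qed (simp add: kron_list_def)

text \<open>In mixed radix the digits of \<open>xs\<close> are shifted past all digits of
  \<open>ys\<close>.\<close>

lemma profile_index_append:
  "distinct (xs @ ys) \<Longrightarrow> profile_index k (xs @ ys) s
    = profile_index k xs s * (\<Prod>j\<in>set ys. k j) + profile_index k ys s"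
proof (induction xs)
  case (Cons a xs)
  then have "(\<Prod>j\<in>set (xs @ ys). k j) = (\<Prod>j\<in>set xs. k j) * (\<Prod>j\<in>set ys. k j)"
    by (simp add: prod.union_disjoint)
  then show ?case using Cons by (simp add: algebra_simps)
qed simp

lemma profile_index_cong:
  "(\<And>j. j \<in> set js \<Longrightarrow> s j = t j) \<Longrightarrow> profile_index k js s = profile_index k js t"
  by (induction js) auto

text \<open>The definite description denotes by \<open>structure_vec_ex1\<close>, and pairing with a
  Kronecker product of unit columns reads off a single entry.\<close>

lemma structure_vec_props:
  assumes "distinct js"
  shows "dim_vec (structure_vec k js f) = (\<Prod>j\<in>set js. k j)"
    and "s \<in> profiles k (set js) \<Longrightarrow> structure_vec k js f $ profile_index k js s = f s"
proof -
  have *: "structure_vec k js f \<in> carrier_vec (\<Prod>j\<in>set js. k j) \<and>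
    (\<forall>s\<in>profiles k (set js). f s = structure_vec k js f \<bullet> kron_list (map (\<lambda>j. delta (k j) (s j)) js))"
    unfolding structure_vec_def by (rule theI'[OF structure_vec_ex1[OF assms]])
  then show "dim_vec (structure_vec k js f) = (\<Prod>j\<in>set js. k j)" by simp
  assume s: "s \<in> profiles k (set js)"
  then have r: "\<forall>j\<in>set js. 1 \<le> s j \<and> s j \<le> k j" using profiles_range by blast
  have "f s = structure_vec k js f \<bullet> unit_vec (\<Prod>j\<in>set js. k j) (profile_index k js s)"
    using * s kron_list_delta[OF assms r] by simp
  then show "structure_vec k js f $ profile_index k js s = f s"
    using * profile_index_less[OF assms r] by (simp add: scalar_prod_right_unit)
qed

lemma dim_concat_vec:
  "(\<And>v. v \<in> set vs \<Longrightarrow> dim_vec v = m) \<Longrightarrow> dim_vec (concat_vec vs) = length vs * m"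
  by (induction vs) (auto simp: concat_vec_def)

lemma concat_vec_index:
  "(\<And>v. v \<in> set vs \<Longrightarrow> dim_vec v = m) \<Longrightarrow> i < length vs \<Longrightarrow> l < m \<Longrightarrow>
    concat_vec vs $ (i * m + l) = vs ! i $ l"
proof (induction vs arbitrary: i)
  case (Cons v vs)
  have d: "dim_vec (concat_vec vs) = length vs * m" using Cons.prems by (intro dim_concat_vec) auto
  have "i * m + l < length (v # vs) * m" using Cons.prems by (intro block_index_less) auto
  then have "concat_vec (v # vs) $ (i * m + l)
    = (if i * m + l < m then v $ (i * m + l) else concat_vec vs $ (i * m + l - m))"
    using Cons.prems(1)[of v] d by (simp add: concat_vec_def)
  then show ?case using Cons by (cases i) auto
qed simp

section \<open>Diagonal matrices, \<Lambda>, and its inverse\<close>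

lemma mat_diag_mult_vec:
  assumes "v \<in> carrier_vec m" "l < m"
  shows "(mat_diag m d *\<^sub>v v) $ l = d l * (v $ l :: real)"
proof -
  have "row (mat_diag m d) l = d l \<cdot>\<^sub>v unit_vec m l"
    using assms by (intro eq_vecI) (auto simp: mat_diag_def)
  then show ?thesis using assms by (simp add: mat_diag_def scalar_prod_left_unit)
qed

text \<open>\<open>mat_inverse\<close> returns an option. Nonzero diagonal entries make the matrix a
  unit, so there is some result \<open>B\<close>, and multiplying \<open>?D * B = 1\<close> from the
  left by the reciprocals identifies it.\<close>

lemma mat_diag_inverse:
  fixes d :: "nat \<Rightarrow> real"
  assumes "\<And>l. l < m \<Longrightarrow> d l \<noteq> 0"
  shows "the (mat_inverse (mat_diag m d)) = mat_diag m (\<lambda>l. inverse (d l))"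
proof -
  let ?D = "mat_diag m d" and ?I = "mat_diag m (\<lambda>l. inverse (d l))"
  have one: "mat_diag m (\<lambda>l. d l * inverse (d l)) = 1\<^sub>m m" "mat_diag m (\<lambda>l. inverse (d l) * d l) = 1\<^sub>m m"
    using assms by (auto simp: mat_diag_def intro!: eq_matI)
  have "?D \<in> Units (ring_mat TYPE(real) m m)"
    unfolding Units_def ring_mat_def using one by (auto intro!: bexI[of _ ?I])
  then obtain B where B: "mat_inverse ?D = Some B"
    using mat_inverse(1)[of ?D m m] by (cases "mat_inverse ?D") auto
  then have "?D * B = 1\<^sub>m m" and car: "B \<in> carrier_mat m m"
    using mat_inverse(2)[OF _ B, of m] by auto
  then have "?I * (?D * B) = ?I" by (simp add: right_mult_one_mat[OF mat_diag_dim])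
  moreover have "?I * (?D * B) = (?I * ?D) * B" 
    using assoc_mult_mat[OF mat_diag_dim mat_diag_dim car] by simp
  ultimately have "B = ?I" using one car by simp
  then show ?thesis using B by simp
qed

lemma set_players [simp]: "set [1..<Suc n] = {1..n}"
  by auto

abbreviation index_of :: "nat \<Rightarrow> (nat \<Rightarrow> nat) \<Rightarrow> (nat \<Rightarrow> nat) \<Rightarrow> nat" where
  "index_of n k \<equiv> profile_index k [1..<Suc n]"

lemma index_of_bij: "bij_betw (index_of n k) (profiles k {1..n}) {..<num_profiles n k}"
  using profile_index_bij[of "[1..<Suc n]" k] unfolding set_players num_profiles_def by simp

lemma index_of_less: "s \<in> profiles k {1..n} \<Longrightarrow> index_of n k s < num_profiles n k"
  using index_of_bij[of k n] unfolding bij_betw_def by blast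

lemma players_split: "i \<in> {1..n} \<Longrightarrow> [1..<Suc n] = [1..<i] @ i # [Suc i..<Suc n]"
  using upt_add_eq_append[of 1 i "Suc n - i"] upt_conv_Cons[of i "Suc n"] by simp

text \<open>The digits a, x, b encode the players before i, player i, and the players after i. The
  all-ones middle factor makes the row independent of x, while the two identity factors select a and
  b.\<close>

lemma row_E_mat:
  assumes a: "a < (\<Prod>j\<in>{1..<i}. k j)" and x: "x < k i" and b: "b < (\<Prod>j\<in>{i<..n}. k j)"
  defines "P \<equiv> \<Prod>j\<in>{1..<i}. k j" and "Q \<equiv> \<Prod>j\<in>{i<..n}. k j"
  shows "a * (k i * Q) + (x * Q + b) < dim_row (E_mat n k i)"
    and "row (E_mat n k i) (a * (k i * Q) + (x * Q + b)) = unit_vec (P * Q) (a * Q + b)"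
proof -
  let ?l = "a * (k i * Q) + (x * Q + b)" and ?F = "mat (k i) 1 (\<lambda>_. 1) \<otimes>\<^sub>m 1\<^sub>m Q"
  have a': "a < P" and b': "b < Q" using a b by (simp_all add: P_def Q_def)
  have E: "E_mat n k i = 1\<^sub>m P \<otimes>\<^sub>m ?F" by (simp add: E_mat_def P_def Q_def)
  have dF: "dim_row ?F = k i * Q" "dim_col ?F = Q" by (simp_all add: kron_mat_def)
  have dE: "dim_row (E_mat n k i) = P * (k i * Q)" "dim_col (E_mat n k i) = P * Q"
    by (simp_all add: E kron_mat_def)
  have lt: "x * Q + b < k i * Q" using x b' by (rule block_index_less)
  show l: "?l < dim_row (E_mat n k i)" unfolding dE using a' lt by (rule block_index_less)
  show "row (E_mat n k i) ?l = unit_vec (P * Q) (a * Q + b)"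
  proof (rule eq_vecI)
    fix m assume "m < dim_vec (unit_vec (P * Q) (a * Q + b) :: real vec)"
    then have m: "m < P * Q" by simp
    let ?c = "m div Q" and ?d = "m mod Q"
    have c: "?c < P" using m by (simp add: less_mult_imp_div_less)
    have d: "?d < Q" using b' by simp
    have md: "m = ?c * Q + ?d" by simp
    have "?F $$ (x * Q + b, ?d) = 1\<^sub>m Q $$ (b, ?d)"
      using kron_mat_index[of x "mat (k i) 1 (\<lambda>_. 1)" b "1\<^sub>m Q" 0 ?d] x b' d by simp
    then have "E_mat n k i $$ (?l, ?c * Q + ?d) = 1\<^sub>m P $$ (a, ?c) * 1\<^sub>m Q $$ (b, ?d)"
      using kron_mat_index[of a "1\<^sub>m P" "x * Q + b" ?F ?c ?d] a' c d lt dF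
      unfolding E by simp
    also have "\<dots> = of_bool (a = ?c \<and> b = ?d)" using a' b' c d by simp
    also have "(a = ?c \<and> b = ?d) = (m = a * Q + b)"
      using b' block_index_div_mod[OF b', of a] md by metis
    finally show "row (E_mat n k i) ?l $ m = unit_vec (P * Q) (a * Q + b) $ m"
      using m l block_index_less[OF a' b'] md by (simp add: dE)
  qed (simp add: dE)
qed

text \<open>The transpose of \<open>E_mat\<close> copies each entry of the weight vector to all
  profiles that extend the given profile of opponents.\<close>

lemma Lambda_mat_diagonal:
  assumes i: "i \<in> {1..n}" and s: "s \<in> profiles k {1..n}"
  shows "(mat_of_row (weight_vec n k w i) * transpose_mat (E_mat n k i)) $$ (0, index_of n k s)
    = w i (s(i := undefined))"
proof -
  let ?P = "\<Prod>j\<in>{1..<i}. k j" and ?Q = "\<Prod>j\<in>{i<..n}. k j" and ?js = "[1..<i] @ [Suc i..<Suc n]"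
  let ?a = "profile_index k [1..<i] s" and ?b = "profile_index k [Suc i..<Suc n] s"
  let ?W = "weight_vec n k w i"
  have sets: "set [1..<i] = {1..<i}" "set [Suc i..<Suc n] = {i<..n}" "set ?js = {1..n} - {i}"
    using i by auto
  have djs: "distinct ?js" by auto
  have rng: "1 \<le> s j \<and> s j \<le> k j" if "j \<in> {1..n}" for j using s that by (rule profiles_range)
  have a: "?a < ?P" using profile_index_less[of "[1..<i]" s k] rng i by simp
  have b: "?b < ?Q" using profile_index_less[of "[Suc i..<Suc n]" s k] rng i unfolding sets by simp
  \<comment> \<open>Removing i keeps the increasing order, so the weight vector is indexed by the
    players before i followed by those after i.\<close>
  have rem: "removeAll i [1..<Suc n] = ?js" using players_split[OF i] by simp
  have ix: "index_of n k s = ?a * (k i * ?Q) + ((s i - 1) * ?Q + ?b)"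
  proof -
    have "(\<Prod>j\<in>set (i # [Suc i..<Suc n]). k j) = k i * ?Q"
      unfolding list.set sets by simp
    moreover have "profile_index k (i # [Suc i..<Suc n]) s = (s i - 1) * ?Q + ?b"
      unfolding profile_index.simps sets ..
    moreover have "distinct ([1..<i] @ i # [Suc i..<Suc n])"
      unfolding players_split[OF i, symmetric] by (rule distinct_upt)
    ultimately show ?thesis
      unfolding players_split[OF i] using profile_index_append[of "[1..<i]" "i # [Suc i..<Suc n]" k s]
      by (simp only:)
  qed
  have ixr: "profile_index k ?js s = ?a * ?Q + ?b"
    using profile_index_append[of "[1..<i]" "[Suc i..<Suc n]" k s, OF djs] unfolding sets .
  have dimW: "dim_vec ?W = ?P * ?Q"
  proof -
    have "{1..n} - {i} = {1..<i} \<union> {i<..n}" using i by auto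
    moreover have "{1..<i} \<inter> {i<..n} = {}" by auto
    ultimately have "(\<Prod>j\<in>{1..n} - {i}. k j) = ?P * ?Q"
      using prod.union_disjoint[of "{1..<i}" "{i<..n}" k] by simp
    then show ?thesis
      unfolding weight_vec_def rem structure_vec_props(1)[OF djs] sets .
  qed
  have W: "?W $ (?a * ?Q + ?b) = w i (s(i := undefined))"
  proof -
    have "s(i := undefined) \<in> profiles k (set ?js)" unfolding sets using s by (rule profiles_del)
    then have "?W $ profile_index k ?js (s(i := undefined)) = w i (s(i := undefined))"
      unfolding weight_vec_def rem by (rule structure_vec_props(2)[OF djs])
    moreover have "profile_index k ?js (s(i := undefined)) = profile_index k ?js s"
      by (rule profile_index_cong) (use sets in auto)
    ultimately show ?thesis unfolding ixr by simp
  qed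
  have si: "s i - 1 < k i" using rng[OF i] by linarith
  have "(mat_of_row ?W * transpose_mat (E_mat n k i)) $$ (0, index_of n k s)
      = ?W \<bullet> row (E_mat n k i) (index_of n k s)"
    using row_E_mat(1)[OF a si b] unfolding ix by simp
  also have "\<dots> = ?W \<bullet> unit_vec (?P * ?Q) (?a * ?Q + ?b)"
    unfolding ix row_E_mat(2)[OF a si b] ..
  also have "\<dots> = ?W $ (?a * ?Q + ?b)"
    using block_index_less[OF a b] dimW by (intro scalar_prod_right_unit carrier_vecI) simp_all
  finally show ?thesis unfolding W .
qed

text \<open>Every position is the index of some profile, so every diagonal entry is a weight and
  hence positive.\<close>

lemma Lambda_inverse:
  assumes i: "i \<in> {1..n}"
    and w: "\<And>t. t \<in> profiles k ({1..n} - {i}) \<Longrightarrow> w i t > 0"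
  shows "the (mat_inverse (Lambda_mat n k w i)) = mat_diag (num_profiles n k)
    (\<lambda>l. inverse ((mat_of_row (weight_vec n k w i) * transpose_mat (E_mat n k i)) $$ (0, l)))"
  unfolding Lambda_mat_def
proof (rule mat_diag_inverse)
  fix l assume "l < num_profiles n k"
  then have "l \<in> index_of n k ` profiles k {1..n}"
    using index_of_bij[of k n] unfolding bij_betw_def by blast
  then obtain t where t: "t \<in> profiles k {1..n}" "l = index_of n k t" by blast
  then show "(mat_of_row (weight_vec n k w i) * transpose_mat (E_mat n k i)) $$ (0, l) \<noteq> 0"
    using Lambda_mat_diagonal[OF i, of t k w] w[OF profiles_del[OF t(1)]] by simp
qed

lemma dim_Lambda_inverse_mult:
  assumes "i \<in> {1..n}" "\<And>t. t \<in> profiles k ({1..n} - {i}) \<Longrightarrow> w i t > 0"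
  shows "dim_vec (the (mat_inverse (Lambda_mat n k w i)) *\<^sub>v v) = num_profiles n k"
  using assms by (subst Lambda_inverse) (auto simp: mat_diag_def)

lemma Lambda_inverse_mult_index:
  assumes i: "i \<in> {1..n}" and s: "s \<in> profiles k {1..n}"
    and w: "\<And>t. t \<in> profiles k ({1..n} - {i}) \<Longrightarrow> w i t > 0"
    and v: "v \<in> carrier_vec (num_profiles n k)"
  shows "(the (mat_inverse (Lambda_mat n k w i)) *\<^sub>v v) $ index_of n k s
    = v $ index_of n k s / w i (s(i := undefined))"
  using mat_diag_mult_vec[OF v index_of_less[OF s]] Lambda_mat_diagonal[OF i s, of w]
    Lambda_inverse[where w = w, OF i w]
  by (simp add: divide_inverse mult.commute)


section \<open>Pure harmonic games and the columns of \<open>B\<close> entrywise\<close>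

text \<open>Blocks are numbered from 1 but positions from 0, hence i - 1. This reads a vector as a
  function of player and profile.\<close>

definition game_entry :: "nat \<Rightarrow> (nat \<Rightarrow> nat) \<Rightarrow> real vec \<Rightarrow> nat \<Rightarrow> (nat \<Rightarrow> nat) \<Rightarrow> real" where
  "game_entry n k v i s = v $ ((i - 1) * num_profiles n k + index_of n k s)"

text \<open>Quotient and remainder modulo the number of profiles recover the block and the position
  inside it; equality and scalar products of vectors reduce to entries in this way.\<close>

lemma game_entry_bij:
  "bij_betw (\<lambda>(i, s). (i - 1) * num_profiles n k + index_of n k s)
     ({1..n} \<times> profiles k {1..n}) {..<n * num_profiles n k}"
proof -
  let ?K = "num_profiles n k" and ?S = "profiles k {1..n}"
  let ?f = "\<lambda>(i, s). (i - 1) * ?K + index_of n k s"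
  note bij = index_of_bij[of k n]
  have "inj_on ?f ({1..n} \<times> ?S)"
  proof (rule inj_onI, clarify)
    fix i s j t
    assume ij: "i \<in> {1..n}" "j \<in> {1..n}" and s: "s \<in> ?S" and t: "t \<in> ?S"
      and e: "(i - 1) * ?K + index_of n k s = (j - 1) * ?K + index_of n k t"
    note ls = index_of_less[OF s] and lt = index_of_less[OF t]
    have "i - 1 = j - 1" "index_of n k s = index_of n k t"
      using arg_cong[OF e, of "\<lambda>x. x div ?K"] arg_cong[OF e, of "\<lambda>x. x mod ?K"]
      unfolding block_index_div_mod[OF ls] block_index_div_mod[OF lt] by blast+
    moreover have "inj_on (index_of n k) ?S" using bij by (simp only: bij_betw_def)
    ultimately have "s = t" using s t by (blast dest: inj_onD)
    moreover have "i = j" using ij \<open>i - 1 = j - 1\<close> unfolding atLeastAtMost_iff by linarith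
    ultimately show "i = j \<and> s = t" by blast
  qed
  moreover have "?f ` ({1..n} \<times> ?S) = {..<n * ?K}"
  proof (intro equalityI subsetI)
    fix l assume "l \<in> ?f ` ({1..n} \<times> ?S)"
    then obtain i s where "i \<in> {1..n}" "s \<in> ?S" "l = (i - 1) * ?K + index_of n k s" by auto
    then show "l \<in> {..<n * ?K}"
      using block_index_less[of "i - 1" n "index_of n k s" ?K] index_of_less[of s k n] by (auto simp del: upt_Suc)
  next
    fix l assume "l \<in> {..<n * ?K}"
    then have l: "l < n * ?K" by simp
    then have "0 < ?K" by (cases ?K) auto
    then have "l mod ?K \<in> index_of n k ` ?S" using bij by (simp add: bij_betw_def del: upt_Suc)
    then obtain s where s: "s \<in> ?S" "l mod ?K = index_of n k s" by blast
    have "l div ?K < n" using l by (simp add: less_mult_imp_div_less)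
    then have "Suc (l div ?K) \<in> {1..n}" by simp
    moreover have "l = ?f (Suc (l div ?K), s)" by (simp only: case_prod_conv diff_Suc_1 s(2)[symmetric] div_mult_mod_eq)
    ultimately show "l \<in> ?f ` ({1..n} \<times> ?S)" using s(1) by blast
  qed
  ultimately show ?thesis unfolding bij_betw_def by blast
qed

lemma game_vec_eqI:
  assumes "u \<in> carrier_vec (n * num_profiles n k)" "v \<in> carrier_vec (n * num_profiles n k)"
    and "\<And>i s. i \<in> {1..n} \<Longrightarrow> s \<in> profiles k {1..n} \<Longrightarrow> game_entry n k u i s = game_entry n k v i s"
  shows "u = v"
proof (rule eq_vecI)
  fix l assume "l < dim_vec v"
  then have "l \<in> (\<lambda>(i, s). (i - 1) * num_profiles n k + index_of n k s) ` ({1..n} \<times> profiles k {1..n})"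
    using game_entry_bij[of n k] assms(2) by (simp add: bij_betw_def del: upt_Suc)
  then show "u $ l = v $ l" using assms(3) by (auto simp: game_entry_def simp del: upt_Suc)
qed (use assms in simp)

lemma game_scalar_prod:
  assumes "v \<in> carrier_vec (n * num_profiles n k)"
  shows "u \<bullet> v = (\<Sum>i\<in>{1..n}. \<Sum>s\<in>profiles k {1..n}. game_entry n k u i s * game_entry n k v i s)"
proof -
  have "u \<bullet> v = (\<Sum>l\<in>{..<n * num_profiles n k}. u $ l * v $ l)"
    using assms by (simp add: scalar_prod_def atLeast0LessThan)
  also have "\<dots> = (\<Sum>x\<in>{1..n} \<times> profiles k {1..n}. case x of (i, s) \<Rightarrow> game_entry n k u i s * game_entry n k v i s)"
    by (subst sum.reindex_bij_betw[OF game_entry_bij, symmetric])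
      (auto simp: game_entry_def simp del: upt_Suc intro!: sum.cong)
  finally show ?thesis by (simp add: sum.cartesian_product)
qed

lemma game_entry_concat_vec:
  assumes "\<And>i. i \<in> {1..n} \<Longrightarrow> dim_vec (f i) = num_profiles n k"
  shows "concat_vec (map f [1..<Suc n]) \<in> carrier_vec (n * num_profiles n k)"
    and "i \<in> {1..n} \<Longrightarrow> s \<in> profiles k {1..n} \<Longrightarrow>
      game_entry n k (concat_vec (map f [1..<Suc n])) i s = f i $ index_of n k s"
proof -
  have d: "dim_vec v = num_profiles n k" if "v \<in> set (map f [1..<Suc n])" for v
    using that assms unfolding set_map set_players by auto
  show "concat_vec (map f [1..<Suc n]) \<in> carrier_vec (n * num_profiles n k)"
    using dim_concat_vec[of "map f [1..<Suc n]", OF d] by (intro carrier_vecI) simp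
  assume i: "i \<in> {1..n}" and s: "s \<in> profiles k {1..n}"
  have "map f [1..<Suc n] ! (i - 1) = f i" using i by (subst nth_map) (auto simp del: upt_Suc)
  moreover have "i - 1 < length (map f [1..<Suc n])" using i by auto
  ultimately show "game_entry n k (concat_vec (map f [1..<Suc n])) i s = f i $ index_of n k s"
    using concat_vec_index[of "map f [1..<Suc n]", OF d _ index_of_less[OF s], of "i - 1"]
    by (simp add: game_entry_def del: upt_Suc)
qed

lemma game_entry_game_vec:
  shows "game_vec n k c \<in> carrier_vec (n * num_profiles n k)"
    and "i \<in> {1..n} \<Longrightarrow> s \<in> profiles k {1..n} \<Longrightarrow> game_entry n k (game_vec n k c) i s = c i s"
proof -
  have d: "dim_vec (structure_vec k [1..<Suc n] (c i)) = num_profiles n k" for i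
    using structure_vec_props(1)[OF distinct_upt, of k 1 "Suc n"] unfolding set_players num_profiles_def .
  show "game_vec n k c \<in> carrier_vec (n * num_profiles n k)"
    unfolding game_vec_def by (rule game_entry_concat_vec(1)) (rule d)
  assume i: "i \<in> {1..n}" and s: "s \<in> profiles k {1..n}"
  then show "game_entry n k (game_vec n k c) i s = c i s"
    unfolding game_vec_def game_entry_concat_vec(2)[OF d i s]
    using structure_vec_props(2)[OF distinct_upt, of s k 1 "Suc n"] unfolding set_players by blast
qed

section \<open>Orthogonality to the potential games as two systems of identities\<close>

lemma game_vec_scalar_prod:
  "h \<bullet> game_vec n k c = (\<Sum>i\<in>{1..n}. \<Sum>s\<in>profiles k {1..n}. game_entry n k h i s * c i s)"
  unfolding game_scalar_prod[OF game_entry_game_vec(1)]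
  by (intro sum.cong refl arg_cong2[where f = "(*)"] game_entry_game_vec(2))

text \<open>The test game pays player i the amount 1 at every profile agreeing with s off i, and
  nothing otherwise. No payoff depends on the player's own strategy, so the potential is 0.\<close>

lemma harmonic_sum_strategies:
  assumes h: "h \<in> pure_harmonic_games n k w" and i: "i \<in> {1..n}" and s: "s \<in> profiles k {1..n}"
  shows "(\<Sum>x\<in>{1..k i}. game_entry n k h i (s(i := x))) = 0"
proof -
  let ?S = "profiles k {1..n}" and ?h = "game_entry n k h"
  define c where "c j t = (of_bool (j = i \<and> t(i := undefined) = s(i := undefined)) :: real)" for j t
  have "coset_weighted_potential_game n k w c"
    unfolding coset_weighted_potential_game_def
    by (intro exI[of _ "\<lambda>_. 0"] ballI) (auto simp: c_def)
  then have "h \<bullet> game_vec n k c = 0"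
    using h unfolding pure_harmonic_games_def vec_module.orthogonal_complement_def potential_games_def by blast
  also have "h \<bullet> game_vec n k c = (\<Sum>j\<in>{1..n}. \<Sum>t\<in>?S. ?h j t * c j t)"
    by (rule game_vec_scalar_prod)
  also have "\<dots> = (\<Sum>j\<in>{1..n}. if j = i then \<Sum>t\<in>?S. ?h i t * of_bool (t(i := undefined) = s(i := undefined)) else 0)"
    by (intro sum.cong refl) (auto simp: c_def)
  also have "\<dots> = (\<Sum>t\<in>?S. ?h i t * of_bool (t(i := undefined) = s(i := undefined)))"
    using i by simp
  also have "\<dots> = (\<Sum>t\<in>profiles k ({1..n} - {i}). \<Sum>x\<in>{1..k i}.
      ?h i (t(i := x)) * of_bool (t(i := undefined) = s(i := undefined)))"
    using i by (subst sum_profiles_coord[of "{1..n}" i]) simp_all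
  also have "\<dots> = (\<Sum>t\<in>profiles k ({1..n} - {i}).
      if t = s(i := undefined) then \<Sum>x\<in>{1..k i}. ?h i (s(i := x)) else 0)"
    by (intro sum.cong refl) (auto simp: profiles_minus_undefined)
  also have "\<dots> = (\<Sum>x\<in>{1..k i}. ?h i (s(i := x)))"
    using profiles_del[OF s, of i] by simp
  finally show ?thesis .
qed

text \<open>The test game pays every player the own weight at s and nothing at other profiles; its
  potential is the indicator of s.\<close>

lemma harmonic_sum_players:
  assumes h: "h \<in> pure_harmonic_games n k w" and s: "s \<in> profiles k {1..n}"
  shows "(\<Sum>i\<in>{1..n}. w i (s(i := undefined)) * game_entry n k h i s) = 0"
proof -
  let ?S = "profiles k {1..n}" and ?h = "game_entry n k h"
  define c where "c j t = w j (t(j := undefined)) * of_bool (t = s)" for j t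
  have "coset_weighted_potential_game n k w c"
    unfolding coset_weighted_potential_game_def
    by (intro exI[of _ "\<lambda>t. of_bool (t = s)"] ballI)
      (simp add: c_def profiles_minus_undefined algebra_simps)
  then have "h \<bullet> game_vec n k c = 0"
    using h unfolding pure_harmonic_games_def vec_module.orthogonal_complement_def potential_games_def by blast
  also have "h \<bullet> game_vec n k c = (\<Sum>j\<in>{1..n}. \<Sum>t\<in>?S. ?h j t * c j t)"
    by (rule game_vec_scalar_prod)
  also have "\<dots> = (\<Sum>j\<in>{1..n}. \<Sum>t\<in>?S. if t = s then w j (s(j := undefined)) * ?h j s else 0)"
    by (intro sum.cong refl) (auto simp: c_def)
  also have "\<dots> = (\<Sum>j\<in>{1..n}. w j (s(j := undefined)) * ?h j s)"
    using s by simp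
  finally show ?thesis .
qed

text \<open>For a game with potential P the difference c_i - w_i P does not depend on the strategy
  of i, so \<open>strat\<close> annihilates it; \<open>play\<close> annihilates the remaining w_i P
  once the sums over players and profiles are exchanged.\<close>

lemma harmonicI:
  assumes k: "\<And>i. i \<in> {1..n} \<Longrightarrow> 1 \<le> k i"
    and h: "h \<in> carrier_vec (n * num_profiles n k)"
    and strat: "\<And>i s. i \<in> {1..n} \<Longrightarrow> s \<in> profiles k {1..n} \<Longrightarrow>
      (\<Sum>x\<in>{1..k i}. game_entry n k h i (s(i := x))) = 0"
    and play: "\<And>s. s \<in> profiles k {1..n} \<Longrightarrow>
      (\<Sum>i\<in>{1..n}. w i (s(i := undefined)) * game_entry n k h i s) = 0"
  shows "h \<in> pure_harmonic_games n k w"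
proof -
  let ?S = "profiles k {1..n}" and ?h = "game_entry n k h"
  have "h \<bullet> game_vec n k c = 0" if "coset_weighted_potential_game n k w c" for c
  proof -
    obtain P where P: "\<And>i s x y. i \<in> {1..n} \<Longrightarrow> s \<in> profiles k ({1..n} - {i}) \<Longrightarrow> x \<in> {1..k i} \<Longrightarrow>
        y \<in> {1..k i} \<Longrightarrow> c i (s(i := x)) - c i (s(i := y)) = w i s * (P (s(i := x)) - P (s(i := y)))"
      using \<open>coset_weighted_potential_game n k w c\<close> unfolding coset_weighted_potential_game_def by blast
    have "(\<Sum>s\<in>?S. ?h i s * (c i s - w i (s(i := undefined)) * P s)) = 0" if i: "i \<in> {1..n}" for i
    proof -
      have one: "1 \<in> {1..k i}" using k[OF i] by simp
      \<comment> \<open>The part of the payoff free of the own strategy, read off at the reference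
        strategy 1.\<close>
      define d where "d t = c i (t(i := 1)) - w i t * P (t(i := 1))" for t
      have "(\<Sum>x\<in>{1..k i}. ?h i (t(i := x)) * (c i (t(i := x)) - w i (t(i := x, i := undefined)) * P (t(i := x)))) = 0"
        if t: "t \<in> profiles k ({1..n} - {i})" for t
      proof -
        have "c i (t(i := x)) - w i (t(i := x, i := undefined)) * P (t(i := x)) = d t" if "x \<in> {1..k i}" for x
          using P[OF i t that one] profiles_minus_undefined[OF t] by (simp add: d_def algebra_simps)
        then have "(\<Sum>x\<in>{1..k i}. ?h i (t(i := x)) * (c i (t(i := x)) - w i (t(i := x, i := undefined)) * P (t(i := x))))
          = (\<Sum>x\<in>{1..k i}. ?h i (t(i := 1, i := x))) * d t"
          unfolding sum_distrib_right by (intro sum.cong refl) simp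
        also have "\<dots> = 0" using strat[OF i profiles_minus_upd[OF t i one]] by simp
        finally show ?thesis .
      qed
      then show ?thesis using i by (subst sum_profiles_coord[of "{1..n}" i]) (auto intro: sum.neutral)
    qed
    then have "(\<Sum>i\<in>{1..n}. \<Sum>s\<in>?S. ?h i s * (c i s - w i (s(i := undefined)) * P s)) = 0" by simp
    moreover have "(\<Sum>i\<in>{1..n}. \<Sum>s\<in>?S. ?h i s * (w i (s(i := undefined)) * P s))
      = (\<Sum>s\<in>?S. (\<Sum>i\<in>{1..n}. w i (s(i := undefined)) * ?h i s) * P s)"
      by (subst sum.swap) (simp add: sum_distrib_left sum_distrib_right mult_ac)
    moreover have "\<dots> = 0" using play by simp
    ultimately show ?thesis
      by (simp add: game_vec_scalar_prod right_diff_distrib sum_subtractf)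
  qed
  then show ?thesis
    using h unfolding pure_harmonic_games_def vec_module.orthogonal_complement_def potential_games_def by blast
qed

section \<open>Entries of the weighted columns\<close>

lemma prod_players_split:
  fixes f :: "nat \<Rightarrow> real"
  assumes "i \<in> {1..n}"
  shows "(\<Prod>q\<in>{1..n}. f q) = (\<Prod>q\<in>{1..<i}. f q) * (f i * (\<Prod>q\<in>{i<..n}. f q))"
proof -
  have "{1..n} = {1..<i} \<union> insert i {i<..n}" using assms by auto
  moreover have "{1..<i} \<inter> insert i {i<..n} = {}" by auto
  ultimately show ?thesis using prod.union_disjoint[of "{1..<i}" "insert i {i<..n}" f] by simp
qed

lemma kron_list_deltas_index:
  assumes "distinct js" "\<And>j. j \<in> set js \<Longrightarrow> 1 \<le> s j \<and> s j \<le> k j" "\<And>j. j \<in> set js \<Longrightarrow> 1 \<le> t j"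
  shows "kron_list (map (\<lambda>j. delta (k j) (t j)) js) $ profile_index k js s = (\<Prod>j\<in>set js. of_bool (s j = t j))"
proof -
  have "kron_list (map (\<lambda>j. delta (k j) (t j)) js) $ profile_index k js s
    = (\<Prod>j\<in>set js. delta (k j) (t j) $ (s j - 1))"
    using assms by (intro kron_list_index) auto
  also have "\<dots> = (\<Prod>j\<in>set js. of_bool (s j = t j))"
    using assms by (intro prod.cong refl delta_index) auto
  finally show ?thesis .
qed

text \<open>At the index of s each Kronecker factor becomes an indicator or a difference of two, and
  the inverse of \<Lambda> becomes division by the weight of player p.\<close>

lemma J_block_entry:
  assumes w: "\<And>i s. i \<in> {1..n} \<Longrightarrow> s \<in> profiles k ({1..n} - {i}) \<Longrightarrow> w i s > 0"
    and r: "r < n" and \<iota>: "\<iota> \<in> profiles k {1..n}" and p: "p \<in> {1..n}"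
  shows "dim_vec (J_block n k w r \<iota> p) = num_profiles n k"
    and "s \<in> profiles k {1..n} \<Longrightarrow>
      J_block n k w r \<iota> p $ index_of n k s = J_fun n r \<iota> p s / w p (s(p := undefined))"
proof -
  show dim: "dim_vec (J_block n k w r \<iota> p) = num_profiles n k"
    using dim_Lambda_inverse_mult[where i = p and n = n and k = k and w = w, OF p w[OF p]] by (auto simp: J_block_def simp del: upt_Suc)
  assume s: "s \<in> profiles k {1..n}"
  have rng: "1 \<le> s q" "s q \<le> k q" "1 \<le> \<iota> q" if "q \<in> {1..n}" for q
    using profiles_range[OF s that] profiles_range[OF \<iota> that] by auto
  have D: "delta (k q) (\<iota> q) $ (s q - 1) = of_bool (s q = \<iota> q)"
    "delta (k q) 1 $ (s q - 1) = of_bool (s q = 1)"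
    "(delta (k q) 1 - delta (k q) (\<iota> q)) $ (s q - 1) = of_bool (s q = 1) - of_bool (s q = \<iota> q)"
    if "q \<in> {1..n}" for q
  proof -
    show 1: "delta (k q) (\<iota> q) $ (s q - 1) = of_bool (s q = \<iota> q)"
      using rng[OF that] by (rule delta_index)
    show 2: "delta (k q) 1 $ (s q - 1) = of_bool (s q = 1)"
      using rng(1,2)[OF that] by (rule delta_index) simp
    have "s q - 1 < k q" using rng[OF that] by linarith
    then show "(delta (k q) 1 - delta (k q) (\<iota> q)) $ (s q - 1) = of_bool (s q = 1) - of_bool (s q = \<iota> q)"
      unfolding 1[symmetric] 2[symmetric] by (intro index_minus_vec) simp
  qed
  note Lam = Lambda_inverse_mult_index[where i = p and n = n and k = k and w = w, OF p s w[OF p]]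
  consider "p \<le> r" | "p = Suc r" | "p > Suc r" by linarith
  then show "J_block n k w r \<iota> p $ index_of n k s = J_fun n r \<iota> p s / w p (s(p := undefined))"
  proof cases
    case 1
    define u where "u q = (if q < p then delta (k q) (\<iota> q)
         else if q = p then delta (k q) 1 - delta (k q) (\<iota> q)
         else if q \<le> r then delta (k q) 1
         else if q = Suc r then delta (k q) 1 - delta (k q) (\<iota> q)
         else delta (k q) (\<iota> q))" for q
    have du: "dim_vec (u q) = k q" for q by (simp add: u_def)
    have car: "kron_list (map u [1..<Suc n]) \<in> carrier_vec (num_profiles n k)"
      using dim_kron_list[OF distinct_upt, of 1 "Suc n" u k] du
      unfolding set_players num_profiles_def by (intro carrier_vecI) simp
    have "kron_list (map u [1..<Suc n]) $ index_of n k s = (\<Prod>q\<in>{1..n}. u q $ (s q - 1))"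
      using kron_list_index[OF distinct_upt, of 1 "Suc n" u k s] du rng unfolding set_players by blast
    also have "\<dots> = (\<Prod>q\<in>{1..<p}. u q $ (s q - 1)) * (u p $ (s p - 1) * (\<Prod>q\<in>{p<..n}. u q $ (s q - 1)))"
      using p by (rule prod_players_split)
    also have "(\<Prod>q\<in>{1..<p}. u q $ (s q - 1)) = (\<Prod>q\<in>{1..<p}. of_bool (s q = \<iota> q))"
      using p D by (intro prod.cong refl) (auto simp: u_def)
    also have "u p $ (s p - 1) = of_bool (s p = 1) - of_bool (s p = \<iota> p)"
      using D(3)[OF p] by (simp add: u_def)
    also have "(\<Prod>q\<in>{p<..n}. u q $ (s q - 1)) = (\<Prod>q\<in>{p<..r}. u q $ (s q - 1))
        * (u (Suc r) $ (s (Suc r) - 1) * (\<Prod>q\<in>{Suc r<..n}. u q $ (s q - 1)))"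
    proof -
      have "{p<..n} = {p<..r} \<union> insert (Suc r) {Suc r<..n}" using 1 r by auto
      moreover have "{p<..r} \<inter> insert (Suc r) {Suc r<..n} = {}" by auto
      ultimately show ?thesis
        using prod.union_disjoint[of "{p<..r}" "insert (Suc r) {Suc r<..n}" "\<lambda>q. u q $ (s q - 1)"] by simp
    qed
    also have "(\<Prod>q\<in>{p<..r}. u q $ (s q - 1)) = (\<Prod>q\<in>{p<..r}. of_bool (s q = 1))"
      using D(2) r by (intro prod.cong refl) (auto simp: u_def)
    also have "u (Suc r) $ (s (Suc r) - 1) = of_bool (s (Suc r) = 1) - of_bool (s (Suc r) = \<iota> (Suc r))"
      using D(3)[of "Suc r"] r 1 by (simp add: u_def)
    also have "(\<Prod>q\<in>{Suc r<..n}. u q $ (s q - 1)) = (\<Prod>q\<in>{Suc r<..n}. of_bool (s q = \<iota> q))"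
      using D(1) 1 by (intro prod.cong refl) (auto simp: u_def)
    finally have "kron_list (map u [1..<Suc n]) $ index_of n k s = J_fun n r \<iota> p s"
      using 1 by (simp add: J_fun_def mult_ac del: upt_Suc)
    moreover have "J_block n k w r \<iota> p = the (mat_inverse (Lambda_mat n k w p)) *\<^sub>v kron_list (map u [1..<Suc n])"
      using 1 by (simp add: J_block_def u_def[abs_def] del: upt_Suc)
    ultimately show ?thesis using Lam[OF _ car] by simp
  next
    case 2
    \<comment> \<open>For r + 1 = n the list \<open>?hi\<close> is empty and its Kronecker product
      is the vector (1), so this case needs no separate treatment.\<close>
    let ?lo = "[1..<Suc r]" and ?hi = "[Suc (Suc r)..<Suc n]"
    let ?A = "kron_list (map (\<lambda>q. delta (k q) 1) ?lo)" and ?B = "kron_list (map (\<lambda>q. delta (k q) (\<iota> q)) ?lo)"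
    let ?M = "delta (k (Suc r)) 1 - delta (k (Suc r)) (\<iota> (Suc r))"
    let ?C = "kron_list (map (\<lambda>q. delta (k q) (\<iota> q)) ?hi)"
    let ?v = "(?A - ?B) \<otimes>\<^sub>v ?M \<otimes>\<^sub>v ?C"
    let ?a = "profile_index k ?lo s" and ?c = "profile_index k ?hi s"
    let ?Q = "\<Prod>q\<in>{Suc r<..n}. k q"
    have hi: "set ?hi = {Suc r<..n}" by auto
    have split: "[1..<Suc n] = ?lo @ Suc r # ?hi" using r by (intro players_split) simp
    have dlo: "distinct (?lo @ Suc r # ?hi)" unfolding split[symmetric] by (rule distinct_upt)
    have lo_n: "q \<in> {1..n}" if "q \<in> set ?lo" for q using that r by auto
    have hi_n: "q \<in> {1..n}" if "q \<in> set ?hi" for q using that by auto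
    have dA: "dim_vec ?A = (\<Prod>q\<in>{1..r}. k q)" "dim_vec ?B = (\<Prod>q\<in>{1..r}. k q)"
      using dim_kron_list[OF distinct_upt, of 1 "Suc r"] unfolding set_players by simp_all
    have dC: "dim_vec ?C = ?Q"
      using dim_kron_list[OF distinct_upt, of "Suc (Suc r)" "Suc n"] unfolding hi by simp
    have a: "?a < dim_vec (?A - ?B)"
      using profile_index_less[OF distinct_upt, of 1 "Suc r" s k] rng r dA unfolding set_players by simp
    have c: "?c < dim_vec ?C"
      unfolding dC using profile_index_less[OF distinct_upt, of "Suc (Suc r)" "Suc n" s k] rng unfolding hi by simp
    have m: "s (Suc r) - 1 < dim_vec ?M" 
    using rng(1)[of "Suc r"] rng(2)[of "Suc r"] r by (auto simp: less_eq_Suc_le)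
    have "profile_index k (Suc r # ?hi) s = (s (Suc r) - 1) * dim_vec ?C + ?c"
      unfolding profile_index.simps hi dC ..
    moreover have "(\<Prod>j\<in>set (Suc r # ?hi). k j) = dim_vec (?M \<otimes>\<^sub>v ?C)"
      unfolding list.set hi dim_kron_vec dC by simp
    ultimately have ix: "index_of n k s = ?a * dim_vec (?M \<otimes>\<^sub>v ?C) + ((s (Suc r) - 1) * dim_vec ?C + ?c)"
      unfolding split using profile_index_append[OF dlo, of k s] by (simp only:)
    have "(s (Suc r) - 1) * dim_vec ?C + ?c < dim_vec (?M \<otimes>\<^sub>v ?C)"
      unfolding dim_kron_vec by (rule block_index_less[OF m c])
    then have "?v $ index_of n k s = (?A - ?B) $ ?a * (?M $ (s (Suc r) - 1) * ?C $ ?c)"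
      unfolding ix by (simp only: kron_vec_index[OF a] kron_vec_index[OF m c])
    also have "(?A - ?B) $ ?a = (\<Prod>q\<in>{1..r}. of_bool (s q = 1)) - (\<Prod>q\<in>{1..r}. of_bool (s q = \<iota> q))"
    proof -
      have "?A $ ?a = (\<Prod>q\<in>set ?lo. of_bool (s q = 1))"
        using rng lo_n by (intro kron_list_deltas_index[where t = "\<lambda>_. 1"] distinct_upt) auto
      moreover have "?B $ ?a = (\<Prod>q\<in>set ?lo. of_bool (s q = \<iota> q))"
        using rng lo_n by (intro kron_list_deltas_index distinct_upt) auto
      ultimately show ?thesis using a unfolding set_players by simp
    qed
    also have "?M $ (s (Suc r) - 1) = of_bool (s (Suc r) = 1) - of_bool (s (Suc r) = \<iota> (Suc r))"
      using D(3)[of "Suc r"] r by simp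
    also have "?C $ ?c = (\<Prod>q\<in>{Suc r<..n}. of_bool (s q = \<iota> q))"
      unfolding hi[symmetric] using rng hi_n by (intro kron_list_deltas_index distinct_upt) auto
    \<comment> \<open>\<open>J_fun\<close> takes the two prefix products in the opposite order,
      which absorbs the minus sign in front of block r + 1.\<close>
    finally have "?v $ index_of n k s = - J_fun n r \<iota> p s"
      using 2 by (simp add: J_fun_def algebra_simps del: upt_Suc)
    moreover have car: "?v \<in> carrier_vec (num_profiles n k)"
    proof -
      have "(\<Prod>q\<in>{1..n}. k q) = (\<Prod>q\<in>set (?lo @ Suc r # ?hi). k q)" 
        unfolding split[symmetric] set_players ..
      also have "\<dots> = dim_vec ?v"
      proof -
        have "set ?lo \<inter> set (Suc r # ?hi) = {}" using dlo unfolding distinct_append by blast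
        then have "(\<Prod>q\<in>set (?lo @ Suc r # ?hi). k q) = (\<Prod>q\<in>set ?lo. k q) * (\<Prod>q\<in>set (Suc r # ?hi). k q)"
          unfolding set_append by (intro prod.union_disjoint) auto
        also have "(\<Prod>q\<in>set (Suc r # ?hi). k q) = k (Suc r) * ?Q" unfolding list.set hi by simp
        also have "(\<Prod>q\<in>set ?lo. k q) = dim_vec (?A - ?B)" unfolding set_players using dA by simp
        finally show ?thesis unfolding dim_kron_vec dC by simp
      qed
      finally show ?thesis unfolding num_profiles_def by (intro carrier_vecI) simp
    qed
    moreover have "J_block n k w r \<iota> p = - (the (mat_inverse (Lambda_mat n k w p)) *\<^sub>v ?v)"
      using 2 by (simp add: J_block_def del: upt_Suc)
    moreover have "dim_vec (the (mat_inverse (Lambda_mat n k w p)) *\<^sub>v ?v) = num_profiles n k"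
      by (rule dim_Lambda_inverse_mult[where i = p and n = n and k = k and w = w, OF p w[OF p]])
    ultimately show ?thesis
      using Lam[OF _ car] index_of_less[OF s] by simp
  next
    case 3
    then show ?thesis using index_of_less[OF s] by (simp add: J_block_def J_fun_def)
  qed
qed

lemma J_col_entry:
  assumes w: "\<And>i s. i \<in> {1..n} \<Longrightarrow> s \<in> profiles k ({1..n} - {i}) \<Longrightarrow> w i s > 0"
    and r: "r < n" and \<iota>: "\<iota> \<in> profiles k {1..n}"
  shows "J_col n k w r \<iota> \<in> carrier_vec (n * num_profiles n k)"
    and "p \<in> {1..n} \<Longrightarrow> s \<in> profiles k {1..n} \<Longrightarrow>
      game_entry n k (J_col n k w r \<iota>) p s = J_fun n r \<iota> p s / w p (s(p := undefined))"
proof -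
  note d = J_block_entry(1)[where w = w, OF w r \<iota>]
  show "J_col n k w r \<iota> \<in> carrier_vec (n * num_profiles n k)"
    unfolding J_col_def by (rule game_entry_concat_vec(1)) (rule d)
  assume p: "p \<in> {1..n}" and s: "s \<in> profiles k {1..n}"
  have "game_entry n k (J_col n k w r \<iota>) p s = J_block n k w r \<iota> p $ index_of n k s"
    unfolding J_col_def by (rule game_entry_concat_vec(2)[OF _ p s]) (rule d)
  also have "\<dots> = J_fun n r \<iota> p s / w p (s(p := undefined))"
    by (rule J_block_entry(2)[where w = w, OF w r \<iota> p s])
  finally show "game_entry n k (J_col n k w r \<iota>) p s = J_fun n r \<iota> p s / w p (s(p := undefined))" .
qed


section \<open>The basis\<close>

definition J_list :: "nat \<Rightarrow> (nat \<Rightarrow> nat) \<Rightarrow> nat \<Rightarrow> (nat \<Rightarrow> nat) list" where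
  "J_list n k r = map (\<lambda>is. restrict (\<lambda>p. is ! (p - 1)) {1..n})
     (filter (\<lambda>is. is ! r \<noteq> 1 \<and> take r is \<noteq> replicate r 1)
       (product_lists (map (\<lambda>p. [1..<Suc (k p)]) [1..<Suc n])))"

lemma J_block_cong:
  assumes "\<And>q. q \<in> {1..n} \<Longrightarrow> \<iota> q = \<iota>' q" "r < n"
  shows "J_block n k w r \<iota> = J_block n k w r \<iota>'"
proof
  fix p
  have "map (\<lambda>q. if q < p then delta (k q) (\<iota> q)
         else if q = p then delta (k q) 1 - delta (k q) (\<iota> q)
         else if q \<le> r then delta (k q) 1
         else if q = Suc r then delta (k q) 1 - delta (k q) (\<iota> q)
         else delta (k q) (\<iota> q)) [1..<Suc n]
    = map (\<lambda>q. if q < p then delta (k q) (\<iota>' q)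
         else if q = p then delta (k q) 1 - delta (k q) (\<iota>' q)
         else if q \<le> r then delta (k q) 1
         else if q = Suc r then delta (k q) 1 - delta (k q) (\<iota>' q)
         else delta (k q) (\<iota>' q)) [1..<Suc n]"
    using assms(1) by (intro map_cong refl) (simp only: set_players)
  moreover have "map (\<lambda>q. delta (k q) (\<iota> q)) [1..<Suc r] = map (\<lambda>q. delta (k q) (\<iota>' q)) [1..<Suc r]"
    using assms by (intro map_cong refl) auto
  moreover have "map (\<lambda>q. delta (k q) (\<iota> q)) [Suc (Suc r)..<Suc n]
      = map (\<lambda>q. delta (k q) (\<iota>' q)) [Suc (Suc r)..<Suc n]"
    using assms by (intro map_cong refl) auto
  moreover have "\<iota> (Suc r) = \<iota>' (Suc r)" using assms by simp
  ultimately show "J_block n k w r \<iota> p = J_block n k w r \<iota>' p" unfolding J_block_def by (simp only:)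
qed

text \<open>Only parameters of the players 1 to n enter a column, so each tuple may be replaced by
  its restriction to them, which is a profile.\<close>

lemma J_cols_eq:
  assumes "r < n"
  shows "J_cols n k w r = map (J_col n k w r) (J_list n k r)"
proof -
  have "J_col n k w r (\<lambda>p. is ! (p - 1)) = J_col n k w r (restrict (\<lambda>p. is ! (p - 1)) {1..n})" for "is"
  proof -
    have "J_block n k w r (\<lambda>p. is ! (p - 1)) = J_block n k w r (restrict (\<lambda>p. is ! (p - 1)) {1..n})"
      using assms by (intro J_block_cong) simp_all
    then show ?thesis unfolding J_col_def by (simp only:)
  qed
  then show ?thesis by (simp add: J_cols_def J_list_def del: upt_Suc)
qed

lemma set_parameter_lists:
  "set (product_lists (map (\<lambda>p. [1..<Suc (k p)]) [1..<Suc n]))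
    = {is. length is = n \<and> (\<forall>p\<in>{1..n}. is ! (p - 1) \<in> {1..k p})}"
proof -
  \<comment> \<open>Shift between list positions, counted from 0, and players, counted from
    1.\<close>
  have *: "(\<forall>i<n. P i) \<longleftrightarrow> (\<forall>p\<in>{1..n}. P (p - 1))" for P
  proof (intro iffI allI impI ballI)
    fix i assume "\<forall>p\<in>{1..n}. P (p - 1)" "i < n"
    then show "P i" by (auto dest!: bspec[of _ _ "Suc i"])
  next
    fix p assume "\<forall>i<n. P i" "p \<in> {1..n}"
    then show "P (p - 1)" by auto
  qed
  have "(map (\<lambda>p. [1..<Suc (k p)]) [1..<Suc n]) ! i = [1..<Suc (k (Suc i))]" if "i < n" for i
    using that by (subst nth_map) (auto simp del: upt_Suc)
  then have "list_all2 (\<lambda>x ys. x \<in> set ys) is (map (\<lambda>p. [1..<Suc (k p)]) [1..<Suc n])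
      \<longleftrightarrow> length is = n \<and> (\<forall>i<n. is ! i \<in> {1..k (Suc i)})" for "is"
    unfolding list_all2_conv_all_nth using set_players by (auto simp del: upt_Suc)
  then show ?thesis unfolding product_lists_set * by auto
qed

lemma take_ne_replicate_iff:
  assumes "r < length xs"
  shows "take r xs \<noteq> replicate r 1 \<longleftrightarrow> (\<exists>q\<in>{1..r}. xs ! (q - 1) \<noteq> (1 :: nat))"
proof -
  have "take r xs = replicate r 1 \<longleftrightarrow> (\<forall>i<r. xs ! i = 1)"
    using assms by (auto simp: list_eq_iff_nth_eq)
  also have "\<dots> \<longleftrightarrow> (\<forall>q\<in>{1..r}. xs ! (q - 1) = 1)"
  proof (intro iffI allI impI ballI)
    fix i assume "\<forall>q\<in>{1..r}. xs ! (q - 1) = 1" "i < r"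
    then show "xs ! i = 1" by (auto dest!: bspec[of _ _ "Suc i"])
  qed auto
  finally show ?thesis by blast
qed

text \<open>A list of length n is recovered from its restriction, so no tuple is listed twice. The
  position r of the list holds the parameter of player r + 1.\<close>

lemma J_list_props:
  assumes r: "r < n"
  shows "distinct (J_list n k r)" and "set (J_list n k r) = J_index n k r"
proof -
  let ?L = "product_lists (map (\<lambda>p. [1..<Suc (k p)]) [1..<Suc n])"
  let ?g = "\<lambda>is::nat list. restrict (\<lambda>p. is ! (p - 1)) {1..n}"
  have "distinct ?L" by (rule distinct_product_lists) auto
  moreover have "inj_on ?g {is. length is = n}"
  proof (rule inj_onI, unfold mem_Collect_eq)
    fix xs ys :: "nat list" assume l: "length xs = n" "length ys = n" and e: "?g xs = ?g ys"
    show "xs = ys"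
    proof (rule nth_equalityI)
      fix i assume "i < length xs"
      then show "xs ! i = ys ! i" using fun_cong[OF e, of "Suc i"] l by simp
    qed (simp add: l)
  qed
  then have "inj_on ?g (set (filter (\<lambda>is. is ! r \<noteq> 1 \<and> take r is \<noteq> replicate r 1) ?L))"
    by (rule inj_on_subset) (use set_parameter_lists[of k n] in auto)
  ultimately show "distinct (J_list n k r)"
    unfolding J_list_def distinct_map by (simp only: distinct_filter simp_thms)
  have ok: "is ! r \<noteq> 1 \<and> take r is \<noteq> replicate r 1 \<longleftrightarrow> ?g is (Suc r) \<noteq> 1 \<and> (\<exists>q\<in>{1..r}. ?g is q \<noteq> 1)"
    if "length is = n" for "is"
    using r that take_ne_replicate_iff[of r "is"] by auto
  show "set (J_list n k r) = J_index n k r"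
  proof (intro equalityI subsetI)
    fix \<iota> assume "\<iota> \<in> set (J_list n k r)"
    then obtain "is" where "is": "length is = n" "\<forall>p\<in>{1..n}. is ! (p - 1) \<in> {1..k p}"
      "is ! r \<noteq> 1 \<and> take r is \<noteq> replicate r 1" and \<iota>: "\<iota> = ?g is"
      unfolding J_list_def set_map set_filter set_parameter_lists by blast
    then have "\<iota> \<in> profiles k {1..n}" by (auto simp: profiles_def PiE_iff extensional_def)
    then show "\<iota> \<in> J_index n k r" using "is" ok[OF "is"(1)] unfolding \<iota> J_index_def by blast
  next
    fix \<iota> assume \<iota>: "\<iota> \<in> J_index n k r"
    let ?is = "map (\<lambda>i. \<iota> (Suc i)) [0..<n]"
    have len: "length ?is = n" by simp
    have S: "\<iota> \<in> profiles k {1..n}" using \<iota> by (simp add: J_index_def)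
    have nth: "?is ! (p - 1) = \<iota> p" if "p \<in> {1..n}" for p using that by auto
    have g: "?g ?is = \<iota>"
      using S nth by (auto simp: profiles_def PiE_iff extensional_def restrict_def)
    have "?is \<in> set ?L" unfolding set_parameter_lists using profiles_range[OF S] nth len by auto
    moreover have "?is ! r \<noteq> 1 \<and> take r ?is \<noteq> replicate r 1"
      unfolding ok[OF len] g using \<iota> by (simp add: J_index_def)
    ultimately have "?g ?is \<in> set (J_list n k r)"
      unfolding J_list_def set_map set_filter by blast
    then show "\<iota> \<in> set (J_list n k r)" unfolding g .
  qed
qed

lemma distinct_concat_Pair:
  assumes "distinct rs" "\<And>r. r \<in> set rs \<Longrightarrow> distinct (f r)"
  shows "distinct (concat (map (\<lambda>r. map (Pair r) (f r)) rs))"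
  using assms by (induction rs) (auto simp: distinct_map inj_on_def)

text \<open>Columns are numbered by pairs (r, \<iota>) because the same tuple can occur in several
  families.\<close>

definition J_params :: "nat \<Rightarrow> (nat \<Rightarrow> nat) \<Rightarrow> (nat \<times> (nat \<Rightarrow> nat)) list" where
  "J_params n k = concat (map (\<lambda>r. map (Pair r) (J_list n k r)) [1..<n])"

lemma J_params_props:
  shows "distinct (J_params n k)" and "set (J_params n k) = Sigma {1..<n} (J_index n k)"
proof -
  show "distinct (J_params n k)"
    unfolding J_params_def by (rule distinct_concat_Pair) (simp_all add: J_list_props)
  show "set (J_params n k) = Sigma {1..<n} (J_index n k)"
    by (auto simp: J_params_def J_list_props)
qed

lemma sum_J_params:
  fixes F :: "nat \<Rightarrow> (nat \<Rightarrow> nat) \<Rightarrow> real"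
  shows "(\<Sum>j<length (J_params n k). case J_params n k ! j of (r, \<iota>) \<Rightarrow> F r \<iota>)
    = (\<Sum>r<n. \<Sum>\<iota>\<in>J_index n k r. F r \<iota>)"
proof -
  have "(\<Sum>j<length (J_params n k). case J_params n k ! j of (r, \<iota>) \<Rightarrow> F r \<iota>)
      = (\<Sum>(r, \<iota>)\<in>Sigma {1..<n} (J_index n k). F r \<iota>)"
    by (rule sum.reindex_bij_betw[OF bij_betw_nth]) (simp_all add: J_params_props)
  also have "\<dots> = (\<Sum>r\<in>{1..<n}. \<Sum>\<iota>\<in>J_index n k r. F r \<iota>)"
    by (simp add: sum.Sigma)
  \<comment> \<open>The additional term r = 0 ranges over the empty index set.\<close>
  also have "\<dots> = (\<Sum>r<n. \<Sum>\<iota>\<in>J_index n k r. F r \<iota>)"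
  proof (rule sum.mono_neutral_left)
    show "\<forall>r\<in>{..<n} - {1..<n}. (\<Sum>\<iota>\<in>J_index n k r. F r \<iota>) = 0"
    proof
      fix r assume "r \<in> {..<n} - {1..<n}"
      then have "r = 0" by auto
      then show "(\<Sum>\<iota>\<in>J_index n k r. F r \<iota>) = 0" by simp
    qed
  qed auto
  finally show ?thesis .
qed

section \<open>Products of \<open>B_mat\<close> with coefficient vectors\<close>

lemma B_mat_eq:
  "B_mat n k w = mat_of_cols (n * num_profiles n k) (map (\<lambda>(r, \<iota>). J_col n k w r \<iota>) (J_params n k))"
proof -
  have *: "map (J_cols n k w) [1..<n] = map (\<lambda>r. map (J_col n k w r) (J_list n k r)) [1..<n]"
    by (intro map_cong refl J_cols_eq) simp
  show ?thesis unfolding B_mat_def J_params_def * by (simp add: map_concat comp_def)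
qed

lemma B_mat_carrier: "B_mat n k w \<in> carrier_mat (n * num_profiles n k) (length (J_params n k))"
  unfolding B_mat_eq by (rule carrier_matI) simp_all

text \<open>At player p and profile s all columns carry the same factor, the reciprocal weight,
  which comes out of the sum.\<close>

lemma B_mat_mult_entry:
  assumes w: "\<And>i s. i \<in> {1..n} \<Longrightarrow> s \<in> profiles k ({1..n} - {i}) \<Longrightarrow> w i s > 0"
    and a: "a \<in> carrier_vec (length (J_params n k))"
    and \<alpha>: "\<And>j. j < length (J_params n k) \<Longrightarrow> a $ j = (case J_params n k ! j of (r, \<iota>) \<Rightarrow> \<alpha> r \<iota>)"
    and p: "p \<in> {1..n}" and s: "s \<in> profiles k {1..n}"
  shows "game_entry n k (B_mat n k w *\<^sub>v a) p s
    = (\<Sum>r<n. \<Sum>\<iota>\<in>J_index n k r. \<alpha> r \<iota> * J_fun n r \<iota> p s) / w p (s(p := undefined))"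
proof -
  let ?m = "length (J_params n k)" and ?l = "(p - 1) * num_profiles n k + index_of n k s"
  have l: "?l < n * num_profiles n k"
    using p by (intro block_index_less index_of_less[OF s]) auto
  have "game_entry n k (B_mat n k w *\<^sub>v a) p s = (\<Sum>j<?m. B_mat n k w $$ (?l, j) * a $ j)"
    using l a B_mat_carrier[of n k w]
    by (simp add: game_entry_def scalar_prod_def atLeast0LessThan del: upt_Suc)
  also have "\<dots> = (\<Sum>j<?m. case J_params n k ! j of (r, \<iota>) \<Rightarrow>
      \<alpha> r \<iota> * J_fun n r \<iota> p s / w p (s(p := undefined)))"
  proof (rule sum.cong[OF refl])
    fix j assume "j \<in> {..<?m}"
    then have j: "j < ?m" by simp
    obtain r \<iota> where ri: "J_params n k ! j = (r, \<iota>)" by fastforce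
    then have "(r, \<iota>) \<in> Sigma {1..<n} (J_index n k)" using j J_params_props(2)[of n k] nth_mem by metis
    then have r: "r < n" and \<iota>: "\<iota> \<in> profiles k {1..n}" by (auto simp: J_index_def)
    have "B_mat n k w $$ (?l, j) = game_entry n k (J_col n k w r \<iota>) p s"
      unfolding B_mat_eq game_entry_def using j l ri by (simp add: mat_of_cols_index del: upt_Suc)
    also have "\<dots> = J_fun n r \<iota> p s / w p (s(p := undefined))"
      by (rule J_col_entry(2)[where w = w, OF w r \<iota> p s])
    finally show "B_mat n k w $$ (?l, j) * a $ j = (case J_params n k ! j of (r, \<iota>) \<Rightarrow>
        \<alpha> r \<iota> * J_fun n r \<iota> p s / w p (s(p := undefined)))"
      using \<alpha>[OF j] ri by simp
  qed
  also have "\<dots> = (\<Sum>r<n. \<Sum>\<iota>\<in>J_index n k r. \<alpha> r \<iota> * J_fun n r \<iota> p s / w p (s(p := undefined)))"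
    by (rule sum_J_params)
  finally show ?thesis by (simp add: sum_divide_distrib)
qed

text \<open>Since no pair (r, \<iota>) repeats, a coefficient vector can be read as a function of r
  and \<iota>.\<close>

lemma J_params_coefficients:
  fixes a :: "real vec"
  shows "\<exists>\<alpha>. \<forall>j<length (J_params n k). a $ j = (case J_params n k ! j of (r, \<iota>) \<Rightarrow> \<alpha> r \<iota>)"
proof -
  let ?P = "J_params n k"
  have "inj_on ((!) ?P) {..<length ?P}" by (rule inj_on_nth) (simp_all add: J_params_props)
  then have "a $ j = (case ?P ! j of (r, \<iota>) \<Rightarrow> a $ (the_inv_into {..<length ?P} ((!) ?P) (r, \<iota>)))"
    if "j < length ?P" for j using that by (simp add: the_inv_into_f_f)
  then show ?thesis by (intro exI[of _ "\<lambda>r \<iota>. a $ (the_inv_into {..<length ?P} ((!) ?P) (r, \<iota>))"]) blast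
qed

text \<open>Cancelling the positive weights turns a kernel vector into a relation among the
  unweighted columns.\<close>

lemma B_mat_injective:
  assumes w: "\<And>i s. i \<in> {1..n} \<Longrightarrow> s \<in> profiles k ({1..n} - {i}) \<Longrightarrow> w i s > 0"
    and a: "a \<in> carrier_vec (length (J_params n k))"
    and zero: "B_mat n k w *\<^sub>v a = 0\<^sub>v (n * num_profiles n k)"
  shows "a = 0\<^sub>v (length (J_params n k))"
proof -
  obtain \<alpha> where \<alpha>: "\<And>j. j < length (J_params n k) \<Longrightarrow> a $ j = (case J_params n k ! j of (r, \<iota>) \<Rightarrow> \<alpha> r \<iota>)"
    using J_params_coefficients[of n k a] by blast
  have sum0: "(\<Sum>r<n. \<Sum>\<iota>\<in>J_index n k r. \<alpha> r \<iota> * J_fun n r \<iota> p s) = 0"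
    if p: "p \<in> {1..n}" and s: "s \<in> profiles k {1..n}" for p s
  proof -
    have "(p - 1) * num_profiles n k + index_of n k s < n * num_profiles n k"
      using p by (intro block_index_less index_of_less[OF s]) auto
    then have "game_entry n k (B_mat n k w *\<^sub>v a) p s = 0" unfolding zero game_entry_def by simp
    moreover have "w p (s(p := undefined)) > 0" by (rule w[OF p profiles_del[OF s]])
    ultimately show ?thesis
      using B_mat_mult_entry[where w = w and \<alpha> = \<alpha>, OF w a \<alpha> p s] by simp
  qed
  show ?thesis
  proof (rule eq_vecI)
    fix j assume "j < dim_vec (0\<^sub>v (length (J_params n k)) :: real vec)"
    then have j: "j < length (J_params n k)" by simp
    obtain r \<iota> where ri: "J_params n k ! j = (r, \<iota>)" by fastforce
    then have "(r, \<iota>) \<in> Sigma {1..<n} (J_index n k)" using j J_params_props(2)[of n k] nth_mem by metis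
    then have "\<alpha> r \<iota> = 0" using J_fun_independent[OF sum0] by auto
    then show "a $ j = 0\<^sub>v (length (J_params n k)) $ j" using \<alpha>[OF j] ri j by simp
  qed (use a in simp)
qed

lemma B_mat_mult_harmonic:
  assumes k: "\<And>i. i \<in> {1..n} \<Longrightarrow> 1 \<le> k i"
    and w: "\<And>i s. i \<in> {1..n} \<Longrightarrow> s \<in> profiles k ({1..n} - {i}) \<Longrightarrow> w i s > 0"
    and a: "a \<in> carrier_vec (length (J_params n k))"
  shows "B_mat n k w *\<^sub>v a \<in> pure_harmonic_games n k w"
proof (rule harmonicI[OF k])
  let ?S = "profiles k {1..n}" and ?v = "B_mat n k w *\<^sub>v a"
  obtain \<alpha> where \<alpha>: "\<And>j. j < length (J_params n k) \<Longrightarrow> a $ j = (case J_params n k ! j of (r, \<iota>) \<Rightarrow> \<alpha> r \<iota>)"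
    using J_params_coefficients[of n k a] by blast
  have entry: "game_entry n k ?v p s
      = (\<Sum>r<n. \<Sum>\<iota>\<in>J_index n k r. \<alpha> r \<iota> * J_fun n r \<iota> p s) / w p (s(p := undefined))"
    if "p \<in> {1..n}" "s \<in> ?S" for p s
    by (rule B_mat_mult_entry[where w = w, OF w a \<alpha> that])
  have IS: "\<iota> \<in> ?S" if "\<iota> \<in> J_index n k r" for \<iota> r using that by (simp add: J_index_def)
  show "?v \<in> carrier_vec (n * num_profiles n k)" using mult_mat_vec_carrier[OF B_mat_carrier a] .
  show "(\<Sum>x\<in>{1..k i}. game_entry n k ?v i (s(i := x))) = 0" if i: "i \<in> {1..n}" and s: "s \<in> ?S" for i s
  proof -
    \<comment> \<open>Changing the strategy of i does not change the opponents' profile, so the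
      weight is a common denominator.\<close>
    have "game_entry n k ?v i (s(i := x))
      = (\<Sum>r<n. \<Sum>\<iota>\<in>J_index n k r. \<alpha> r \<iota> * J_fun n r \<iota> i (s(i := x))) / w i (s(i := undefined))"
      if "x \<in> {1..k i}" for x
      using entry[OF i profiles_upd[OF s i that]] by simp
    then have "(\<Sum>x\<in>{1..k i}. game_entry n k ?v i (s(i := x)))
      = (\<Sum>x\<in>{1..k i}. \<Sum>r<n. \<Sum>\<iota>\<in>J_index n k r. \<alpha> r \<iota> * J_fun n r \<iota> i (s(i := x))) / w i (s(i := undefined))"
      unfolding sum_divide_distrib[of _ "{1..k i}"] by (intro sum.cong refl)
    also have "(\<Sum>x\<in>{1..k i}. \<Sum>r<n. \<Sum>\<iota>\<in>J_index n k r. \<alpha> r \<iota> * J_fun n r \<iota> i (s(i := x)))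
      = (\<Sum>r<n. \<Sum>\<iota>\<in>J_index n k r. \<alpha> r \<iota> * (\<Sum>x\<in>{1..k i}. J_fun n r \<iota> i (s(i := x))))"
      by (subst sum.swap) (intro sum.cong refl, subst sum.swap, simp only: sum_distrib_left)
    also have "\<dots> = 0"
      using J_fun_sum_strategies[OF IS i] by (intro sum.neutral ballI) auto
    finally show ?thesis unfolding div_0 .
  qed
  show "(\<Sum>i\<in>{1..n}. w i (s(i := undefined)) * game_entry n k ?v i s) = 0" if s: "s \<in> ?S" for s
  proof -
    have "w i (s(i := undefined)) * game_entry n k ?v i s
      = (\<Sum>r<n. \<Sum>\<iota>\<in>J_index n k r. \<alpha> r \<iota> * J_fun n r \<iota> i s)" if i: "i \<in> {1..n}" for i
      using entry[OF i s] w[OF i profiles_del[OF s]] by simp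
    then have "(\<Sum>i\<in>{1..n}. w i (s(i := undefined)) * game_entry n k ?v i s)
      = (\<Sum>i\<in>{1..n}. \<Sum>r<n. \<Sum>\<iota>\<in>J_index n k r. \<alpha> r \<iota> * J_fun n r \<iota> i s)"
      by (intro sum.cong refl)
    also have "\<dots> = (\<Sum>r<n. \<Sum>\<iota>\<in>J_index n k r. \<alpha> r \<iota> * (\<Sum>i\<in>{1..n}. J_fun n r \<iota> i s))"
      by (subst sum.swap) (intro sum.cong refl, subst sum.swap, simp only: sum_distrib_left)
    also have "\<dots> = 0" using J_fun_sum_players by (intro sum.neutral ballI) auto
    finally show ?thesis .
  qed
qed

lemma harmonic_B_mat_mult:
  assumes k: "\<And>i. i \<in> {1..n} \<Longrightarrow> 1 \<le> k i"
    and w: "\<And>i s. i \<in> {1..n} \<Longrightarrow> s \<in> profiles k ({1..n} - {i}) \<Longrightarrow> w i s > 0"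
    and h: "h \<in> pure_harmonic_games n k w"
  shows "\<exists>a\<in>carrier_vec (length (J_params n k)). B_mat n k w *\<^sub>v a = h"
proof -
  let ?S = "profiles k {1..n}" and ?m = "length (J_params n k)"
  \<comment> \<open>Multiplying block i by \<Lambda> removes the weights and leads to the unweighted
    identities.\<close>
  define g where "g i s = w i (s(i := undefined)) * game_entry n k h i s" for i s
  \<comment> \<open>Spanning is used with \<open>m\<close> equal to n, where no block has to vanish
    in advance.\<close>
  have "\<exists>\<alpha>. \<forall>p\<in>{1..n}. \<forall>s\<in>?S. g p s = (\<Sum>r<n. \<Sum>\<iota>\<in>J_index n k r. \<alpha> r \<iota> * J_fun n r \<iota> p s)"
  proof (rule J_fun_span[OF k])
    show "(\<Sum>x\<in>{1..k i}. g i (s(i := x))) = 0" if "i \<in> {1..n}" "s \<in> ?S" for i s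
    proof -
      have "(\<Sum>x\<in>{1..k i}. g i (s(i := x)))
        = w i (s(i := undefined)) * (\<Sum>x\<in>{1..k i}. game_entry n k h i (s(i := x)))"
        unfolding sum_distrib_left by (simp add: g_def)
      then show ?thesis using harmonic_sum_strategies[OF h that] by simp
    qed
    show "(\<Sum>i\<in>{1..n}. g i s) = 0" if "s \<in> ?S" for s
      unfolding g_def by (rule harmonic_sum_players[OF h that])
  qed auto
  then obtain \<alpha> where \<alpha>: "\<And>p s. p \<in> {1..n} \<Longrightarrow> s \<in> ?S \<Longrightarrow>
      g p s = (\<Sum>r<n. \<Sum>\<iota>\<in>J_index n k r. \<alpha> r \<iota> * J_fun n r \<iota> p s)" by blast
  define a where "a = vec ?m (\<lambda>j. case J_params n k ! j of (r, \<iota>) \<Rightarrow> \<alpha> r \<iota>)"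
  have a_j: "a $ j = (case J_params n k ! j of (r, \<iota>) \<Rightarrow> \<alpha> r \<iota>)" if "j < ?m" for j
    using that by (simp add: a_def)
  have car: "a \<in> carrier_vec ?m" by (simp add: a_def)
  have "B_mat n k w *\<^sub>v a = h"
  proof (rule game_vec_eqI)
    show "B_mat n k w *\<^sub>v a \<in> carrier_vec (n * num_profiles n k)" using mult_mat_vec_carrier[OF B_mat_carrier car] .
    show "h \<in> carrier_vec (n * num_profiles n k)"
      using h unfolding pure_harmonic_games_def vec_module.orthogonal_complement_def by blast
    fix p s assume p: "p \<in> {1..n}" and s: "s \<in> ?S"
    have "w p (s(p := undefined)) > 0" by (rule w[OF p profiles_del[OF s]])
    then show "game_entry n k (B_mat n k w *\<^sub>v a) p s = game_entry n k h p s"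
      using B_mat_mult_entry[where w = w and \<alpha> = \<alpha>, OF w car a_j p s] \<alpha>[OF p s, symmetric] by (simp add: g_def)
  qed
  then show ?thesis using car by blast
qed

theorem theorem19:
  fixes n :: nat and k :: "nat \<Rightarrow> nat" and w :: "nat \<Rightarrow> (nat \<Rightarrow> nat) \<Rightarrow> real"
  assumes "n \<ge> 2"
    and "\<And>i. i \<in> {1..n} \<Longrightarrow> k i \<ge> 2"
    and "\<And>i s. i \<in> {1..n} \<Longrightarrow> s \<in> profiles k ({1..n} - {i}) \<Longrightarrow> w i s > 0"
  shows "vec_space.rank (n * num_profiles n k) (B_mat n k w) = dim_col (B_mat n k w)
    \<and> pure_harmonic_games n k w = vec_space.col_space (n * num_profiles n k) (B_mat n k w)
    \<and> vectorspace.basis class_ring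
        (vectorspace.vs (module_vec TYPE(real) (n * num_profiles n k)) (pure_harmonic_games n k w))
        (set (cols (B_mat n k w)))"
proof -
  let ?N = "n * num_profiles n k" and ?m = "length (J_params n k)"
  interpret vec_space "TYPE(real)" ?N .
  note w = assms(3)
  have k: "1 \<le> k i" if "i \<in> {1..n}" for i using assms(2)[OF that] by simp
  note B = B_mat_carrier[of n k w]
  have inj: "a = 0\<^sub>v ?m" if "a \<in> carrier_vec ?m" "B_mat n k w *\<^sub>v a = 0\<^sub>v ?N" for a
    using B_mat_injective[where w = w, OF w that] .
  have "pure_harmonic_games n k w \<subseteq> carrier_vec ?N"
    unfolding pure_harmonic_games_def orthogonal_complement_def by blast
  \<comment> \<open>The column space consists of the products of \<open>B_mat\<close> with
    coefficient vectors; the two inclusions are the two preceding lemmas.\<close>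
  then have H: "pure_harmonic_games n k w = col_space (B_mat n k w)"
    unfolding col_space_eq[OF B]
    using B_mat_mult_harmonic[where w = w, OF k w] harmonic_B_mat_mult[where w = w, OF k w] B
    by auto
  \<comment> \<open>The trivial kernel gives the rank and a basis of the column space, which
    \<open>H\<close> identifies with the harmonic games.\<close>
  show ?thesis
    using inj_mat_cols_basis[OF B inj] B unfolding H by simp
qed

end
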